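(* Let $\Sigma$ be a finite alphabet. Every language $L\subseteq\Sigma^*$ that is definable by a sentence of $\mathsf{FOC}[+;\mathsf{MOD}]$ is also recognizable by a transformer classifier.
   Context: **The logic $\mathsf{FOC}[+;\mathsf{MOD}]$.** Fix a finite alphabet $\Sigma$. Formulas are interpreted in finite strings $w=w_1\cdots w_n\in\Sigma^*$. There are two sorts. Position variables $p,q,\dots$ range over integers in $[1,n]$. Count variables $x,y,z,\dots$ range over the rational numbers; count terms are $c_0+c_1x_1+\dots+c_kx_k$ with rational constants $c_i$ and count variables $x_i$. Formulas are: $\top$ (true), $\bot$ (false); $Q_a(p)$ for $a\in\Sigma$, true iff $w_p=a$; $\mathsf{MOD}^r_m(p)$ for integers $r\ge0$, $m>0$, true iff $p\equiv r \pmod m$; $t_1=t_2$ and $t_1<t_2$ for count terms $t_1,t_2$; $\phi_1\land\phi_2$, $\phi_1\lor\phi_2$, $\neg\phi_1$; $\exists x.\phi$ and $\forall x.\phi$ for a count variable $x$ (quantifying over the rationals); and $\exists^{=x}p.\phi$ for a count variable $x$ and position variable $p$, true iff $\phi$ is true for exactly $x$ values of $p\in[1,n]$ (this binds $p$ but leaves $x$ free). A sentence is a formula with no free variables. The language defined by a sentence $\sigma$ is $\{w\in\Sigma^*\mid w\models\sigma\}$. **Transformer classifiers** (arbitrary precision: exact real arithmetic). Let $\mathrm{CLS}\notin\Sigma$ be a special symbol. For $w=w_1\cdots w_n\in\Sigma^*$ put $n'=n+1$ and $w_0=\mathrm{CLS}$; matrices in $\mathbb R^{d\times n'}$ have rows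 indexed $1,\dots,d$ and columns indexed $0,\dots,n$; $A_{*,p}$ is column $p$ of $A$. A word embedding of width $d$ is a map $\mathrm{WE}\colon\Sigma\cup\{\mathrm{CLS}\}\to\mathbb R^d$. A sinusoidal positional encoding of even width $d$ is $\mathrm{PE}(p)=(\sin 2\pi\xi_1p,\cos 2\pi\xi_1p,\dots,\sin2\pi\xi_{d/2}p,\cos2\pi\xi_{d/2}p)^\top$ with arbitrary $\xi_i\in\mathbb Q$. A self-attention $\mathrm{SA}$ of width $d$ and key width $d_K$ has parameters $W^{(Q)},W^{(K)}\in\mathbb R^{d_K\times d}$, $W^{(V)}\in\mathbb R^{d\times d}$ and maps $A\in\mathbb R^{d\times n'}$ to $[c_0\ \cdots\ c_n]$ where $s_{qp}=\frac{W^{(Q)}A_{*,q}\cdot W^{(K)}A_{*,p}}{\sqrt d}$ and $c_q=\frac{\sum_{p=0}^n(\exp s_{qp})W^{(V)}A_{*,p}}{\sum_{p=0}^n\exp s_{qp}}$. A position-wise feed-forward network (FFN) of width $d$ and hidden width $d_{FF}$ is $\mathrm{FF}(x)=W^{(2)}\max(0,W^{(1)}x+b^{(1)})+b^{(2)}$ (max elementwise) with $W^{(1)}\in\mathbb R^{d_{FF}\times d}$, $b^{(1)}\in\mathbb R^{d_{FF}}$, $W^{(2)}\in\mathbb R^{d\times d_{FF}}$, $b^{(2)}\in\mathbb R^d$, applied to matrices columnwise. A transformer layer with $H$ heads maps $A$ to $A''=\mathrm{FF}(A')+A'$ where $A'=\sum_{h=1}^H\mathrm{SA}^{(h)}(A)+A$.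 A transformer stack of width $d$ is a composition of $L\ge0$ layers of width $d$. A transformer encoder of width $d$ maps $w$ to $\mathrm{Enc}(w)=\mathrm{Stack}(A)\in\mathbb R^{d\times n'}$ where $A_{*,p}=\mathrm{WE}(w_p)+\mathrm{PE}(p)$, $0\le p\le n$. A transformer classifier is $\mathrm{Cls}(w)=\mathrm{sigmoid}(W[\mathrm{Enc}(w)]_{*,0}+b)$ with $W\in\mathbb R^{1\times d}$, $b\in\mathbb R$; it accepts $w$ iff $\mathrm{Cls}(w)\ge\frac12$, and recognizes the language $\{w\in\Sigma^*\mid \mathrm{Cls}\text{ accepts }w\}$. All parameters (including the number of layers, heads, widths) are fixed independently of $n$. *)

theory Defs
  imports Complex_Main "Jordan_Normal_Form.Matrix"
begin

section \<open>The logic FOC[+;MOD]\<close>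

text \<open>
  Both sorts of variables are named by natural numbers; the constructors keep the two name spaces
  apart.  \<open>CTerm c0 [(c1, x1), \<dots>, (ck, xk)]\<close> is the count term \<open>c0 + c1 x1 + \<dots> + ck xk\<close>.
\<close>

type_synonym pvar = nat
type_synonym cvar = nat

datatype cterm = CTerm rat "(rat \<times> cvar) list"

datatype 'a formula =
    Top
  | Bot
  | Letter 'a pvar
  | Mod nat nat pvar  \<comment> \<open>residue first, then modulus\<close>
  | Eq cterm cterm
  | Less cterm cterm
  | And "'a formula" "'a formula"
  | Or "'a formula" "'a formula"
  | Neg "'a formula"
  | Exists cvar "'a formula"
  | Forall cvar "'a formula"
  | ExCount cvar pvar "'a formula"  \<comment> \<open>\<open>ExCount x p \<phi>\<close>: exactly \<open>x\<close> positions \<open>p\<close> satisfy \<open>\<phi>\<close>\<close>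

fun cterm_val :: "(cvar \<Rightarrow> rat) \<Rightarrow> cterm \<Rightarrow> rat" where
  "cterm_val \<beta> (CTerm c0 cs) = c0 + (\<Sum>(c, x)\<leftarrow>cs. c * \<beta> x)"

fun cterm_vars :: "cterm \<Rightarrow> cvar set" where
  "cterm_vars (CTerm c0 cs) = snd ` set cs"

text \<open>
  Positions are counted from 1, whereas list indices start at 0.  The assignment \<open>\<alpha>\<close> of positions is
  a total function; its values outside \<open>{1..length w}\<close> are never consulted for bound variables.
\<close>

fun sat :: "'a list \<Rightarrow> (pvar \<Rightarrow> nat) \<Rightarrow> (cvar \<Rightarrow> rat) \<Rightarrow> 'a formula \<Rightarrow> bool" where
  "sat w \<alpha> \<beta> Top \<longleftrightarrow> True"
| "sat w \<alpha> \<beta> Bot \<longleftrightarrow> False"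
| "sat w \<alpha> \<beta> (Letter a p) \<longleftrightarrow> w ! (\<alpha> p - 1) = a"
| "sat w \<alpha> \<beta> (Mod r m p) \<longleftrightarrow> \<alpha> p mod m = r mod m"
| "sat w \<alpha> \<beta> (Eq s t) \<longleftrightarrow> cterm_val \<beta> s = cterm_val \<beta> t"
| "sat w \<alpha> \<beta> (Less s t) \<longleftrightarrow> cterm_val \<beta> s < cterm_val \<beta> t"
| "sat w \<alpha> \<beta> (And \<phi> \<psi>) \<longleftrightarrow> sat w \<alpha> \<beta> \<phi> \<and> sat w \<alpha> \<beta> \<psi>"
| "sat w \<alpha> \<beta> (Or \<phi> \<psi>) \<longleftrightarrow> sat w \<alpha> \<beta> \<phi> \<or> sat w \<alpha> \<beta> \<psi>"
| "sat w \<alpha> \<beta> (Neg \<phi>) \<longleftrightarrow> \<not> sat w \<alpha> \<beta> \<phi>"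
| "sat w \<alpha> \<beta> (Exists x \<phi>) \<longleftrightarrow> (\<exists>c. sat w \<alpha> (\<beta>(x := c)) \<phi>)"
| "sat w \<alpha> \<beta> (Forall x \<phi>) \<longleftrightarrow> (\<forall>c. sat w \<alpha> (\<beta>(x := c)) \<phi>)"
| "sat w \<alpha> \<beta> (ExCount x p \<phi>) \<longleftrightarrow>
     of_nat (card {i \<in> {1..length w}. sat w (\<alpha>(p := i)) \<beta> \<phi>}) = \<beta> x"

fun free_pvars :: "'a formula \<Rightarrow> pvar set" where
  "free_pvars (Letter a p) = {p}"
| "free_pvars (Mod r m p) = {p}"
| "free_pvars (And \<phi> \<psi>) = free_pvars \<phi> \<union> free_pvars \<psi>"
| "free_pvars (Or \<phi> \<psi>) = free_pvars \<phi> \<union> free_pvars \<psi>"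
| "free_pvars (Neg \<phi>) = free_pvars \<phi>"
| "free_pvars (Exists x \<phi>) = free_pvars \<phi>"
| "free_pvars (Forall x \<phi>) = free_pvars \<phi>"
| "free_pvars (ExCount x p \<phi>) = free_pvars \<phi> - {p}"
| "free_pvars Top = {}"
| "free_pvars Bot = {}"
| "free_pvars (Eq s t) = {}"
| "free_pvars (Less s t) = {}"

fun free_cvars :: "'a formula \<Rightarrow> cvar set" where
  "free_cvars (Eq s t) = cterm_vars s \<union> cterm_vars t"
| "free_cvars (Less s t) = cterm_vars s \<union> cterm_vars t"
| "free_cvars (And \<phi> \<psi>) = free_cvars \<phi> \<union> free_cvars \<psi>"
| "free_cvars (Or \<phi> \<psi>) = free_cvars \<phi> \<union> free_cvars \<psi>"
| "free_cvars (Neg \<phi>) = free_cvars \<phi>"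
| "free_cvars (Exists x \<phi>) = free_cvars \<phi> - {x}"
| "free_cvars (Forall x \<phi>) = free_cvars \<phi> - {x}"
| "free_cvars (ExCount x p \<phi>) = insert x (free_cvars \<phi>)"
| "free_cvars Top = {}"
| "free_cvars Bot = {}"
| "free_cvars (Letter a p) = {}"
| "free_cvars (Mod r m p) = {}"

text \<open>The side conditions of the grammar: letters come from the alphabet, moduli are positive.\<close>

fun wf_formula :: "'a set \<Rightarrow> 'a formula \<Rightarrow> bool" where
  "wf_formula \<Sigma> (Letter a p) \<longleftrightarrow> a \<in> \<Sigma>"
| "wf_formula \<Sigma> (Mod r m p) \<longleftrightarrow> m > 0"
| "wf_formula \<Sigma> (And \<phi> \<psi>) \<longleftrightarrow> wf_formula \<Sigma> \<phi> \<and> wf_formula \<Sigma> \<psi>"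
| "wf_formula \<Sigma> (Or \<phi> \<psi>) \<longleftrightarrow> wf_formula \<Sigma> \<phi> \<and> wf_formula \<Sigma> \<psi>"
| "wf_formula \<Sigma> (Neg \<phi>) \<longleftrightarrow> wf_formula \<Sigma> \<phi>"
| "wf_formula \<Sigma> (Exists x \<phi>) \<longleftrightarrow> wf_formula \<Sigma> \<phi>"
| "wf_formula \<Sigma> (Forall x \<phi>) \<longleftrightarrow> wf_formula \<Sigma> \<phi>"
| "wf_formula \<Sigma> (ExCount x p \<phi>) \<longleftrightarrow> wf_formula \<Sigma> \<phi>"
| "wf_formula \<Sigma> Top \<longleftrightarrow> True"
| "wf_formula \<Sigma> Bot \<longleftrightarrow> True"
| "wf_formula \<Sigma> (Eq s t) \<longleftrightarrow> True"
| "wf_formula \<Sigma> (Less s t) \<longleftrightarrow> True"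

definition sentence :: "'a set \<Rightarrow> 'a formula \<Rightarrow> bool" where
  "sentence \<Sigma> \<sigma> \<longleftrightarrow> wf_formula \<Sigma> \<sigma> \<and> free_pvars \<sigma> = {} \<and> free_cvars \<sigma> = {}"

lemma cterm_val_cong:
  "(\<And>x. x \<in> cterm_vars t \<Longrightarrow> \<beta> x = \<beta>' x) \<Longrightarrow> cterm_val \<beta> t = cterm_val \<beta>' t"
  by (cases t) (force intro!: arg_cong[where f = sum_list] map_cong)

lemma sat_cong:
  assumes "\<And>p. p \<in> free_pvars \<phi> \<Longrightarrow> \<alpha> p = \<alpha>' p"
    and "\<And>x. x \<in> free_cvars \<phi> \<Longrightarrow> \<beta> x = \<beta>' x"
  shows "sat w \<alpha> \<beta> \<phi> \<longleftrightarrow> sat w \<alpha>' \<beta>' \<phi>"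
  using assms
proof (induction \<phi> arbitrary: \<alpha> \<alpha>' \<beta> \<beta>')
  case (Eq s t)
  then show ?case using cterm_val_cong[of s \<beta> \<beta>'] cterm_val_cong[of t \<beta> \<beta>'] by simp
next
  case (Less s t)
  then show ?case using cterm_val_cong[of s \<beta> \<beta>'] cterm_val_cong[of t \<beta> \<beta>'] by simp
next
  case (And \<phi> \<psi>)
  then show ?case by (metis UnCI free_cvars.simps(3) free_pvars.simps(3) sat.simps(7))
next
  case (Or \<phi> \<psi>)
  then show ?case by (metis UnCI free_cvars.simps(4) free_pvars.simps(4) sat.simps(8))
next
  case (Neg \<phi>)
  then show ?case by (metis free_cvars.simps(5) free_pvars.simps(5) sat.simps(9))
next
  case (Exists x \<phi>)
  have "sat w \<alpha> (\<beta>(x := c)) \<phi> \<longleftrightarrow> sat w \<alpha>' (\<beta>'(x := c)) \<phi>" for c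
    using Exists.prems by (intro Exists.IH) auto
  then show ?case by simp
next
  case (Forall x \<phi>)
  have "sat w \<alpha> (\<beta>(x := c)) \<phi> \<longleftrightarrow> sat w \<alpha>' (\<beta>'(x := c)) \<phi>" for c
    using Forall.prems by (intro Forall.IH) auto
  then show ?case by simp
next
  case (ExCount x p \<phi>)
  have "sat w (\<alpha>(p := i)) \<beta> \<phi> \<longleftrightarrow> sat w (\<alpha>'(p := i)) \<beta>' \<phi>" for i
    using ExCount.prems by (intro ExCount.IH) auto
  then show ?case using ExCount.prems(2)[of x] by simp
qed simp_all

text \<open>By \<open>sat_cong\<close>, the quantification over assignments is immaterial for sentences.\<close>

definition models :: "'a list \<Rightarrow> 'a formula \<Rightarrow> bool" (infix "\<Turnstile>" 50) where
  "w \<Turnstile> \<sigma> \<longleftrightarrow> (\<forall>\<alpha> \<beta>. sat w \<alpha> \<beta> \<sigma>)"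

definition foc_language :: "'a set \<Rightarrow> 'a formula \<Rightarrow> 'a list set" where
  "foc_language \<Sigma> \<sigma> = {w \<in> lists \<Sigma>. w \<Turnstile> \<sigma>}"

definition foc_definable :: "'a set \<Rightarrow> 'a list set \<Rightarrow> bool" where
  "foc_definable \<Sigma> L \<longleftrightarrow> (\<exists>\<sigma>. sentence \<Sigma> \<sigma> \<and> L = foc_language \<Sigma> \<sigma>)"


section \<open>Transformer classifiers\<close>

text \<open>
  Matrices and vectors carry their dimensions, which the \<open>wf\<close> predicates prescribe.  Rows are
  indexed from 0 here; columns are indexed \<open>0, \<dots>, n\<close>, with \<open>CLS\<close> at column 0.
\<close>

record attention =
  WQ :: "real mat"
  WK :: "real mat"
  WV :: "real mat"

definition wf_attention :: "nat \<Rightarrow> attention \<Rightarrow> bool" where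
  "wf_attention d S \<longleftrightarrow>
     (\<exists>dK>0. WQ S \<in> carrier_mat dK d \<and> WK S \<in> carrier_mat dK d \<and> WV S \<in> carrier_mat d d)"

definition att_score :: "attention \<Rightarrow> real mat \<Rightarrow> nat \<Rightarrow> nat \<Rightarrow> real" where
  "att_score S A q p =
     ((WQ S *\<^sub>v col A q) \<bullet> (WK S *\<^sub>v col A p)) / sqrt (real (dim_row A))"

definition self_attention :: "attention \<Rightarrow> real mat \<Rightarrow> real mat" where
  "self_attention S A = mat (dim_row A) (dim_col A) (\<lambda>(i, q).
     (\<Sum>p<dim_col A. exp (att_score S A q p) * (WV S *\<^sub>v col A p) $ i) /
     (\<Sum>p<dim_col A. exp (att_score S A q p)))"

record ffn =
  ff_W1 :: "real mat"
  ff_b1 :: "real vec"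
  ff_W2 :: "real mat"
  ff_b2 :: "real vec"

definition wf_ffn :: "nat \<Rightarrow> ffn \<Rightarrow> bool" where
  "wf_ffn d F \<longleftrightarrow>
     (\<exists>dFF>0. ff_W1 F \<in> carrier_mat dFF d \<and> ff_b1 F \<in> carrier_vec dFF \<and>
              ff_W2 F \<in> carrier_mat d dFF \<and> ff_b2 F \<in> carrier_vec d)"

definition ffn_apply :: "ffn \<Rightarrow> real vec \<Rightarrow> real vec" where
  "ffn_apply F x = ff_W2 F *\<^sub>v map_vec (max 0) (ff_W1 F *\<^sub>v x + ff_b1 F) + ff_b2 F"

definition ffn_columnwise :: "ffn \<Rightarrow> real mat \<Rightarrow> real mat" where
  "ffn_columnwise F A = mat_of_cols (dim_row A) (map (ffn_apply F) (cols A))"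

record layer =
  heads :: "attention list"
  feed_forward :: ffn

definition wf_layer :: "nat \<Rightarrow> layer \<Rightarrow> bool" where
  "wf_layer d l \<longleftrightarrow>
     heads l \<noteq> [] \<and> (\<forall>S \<in> set (heads l). wf_attention d S) \<and> wf_ffn d (feed_forward l)"

text \<open>The fold computes \<open>SA\<^sub>1(A) + (\<dots> + (SA\<^sub>H(A) + A))\<close>.\<close>

definition layer_apply :: "layer \<Rightarrow> real mat \<Rightarrow> real mat" where
  "layer_apply l A =
     (let A' = foldr (\<lambda>S B. self_attention S A + B) (heads l) A
      in ffn_columnwise (feed_forward l) A' + A')"

definition stack_apply :: "layer list \<Rightarrow> real mat \<Rightarrow> real mat" where
  "stack_apply ls A = fold layer_apply ls A"

text \<open>The symbol \<open>CLS\<close> is \<open>None\<close>; a letter \<open>a\<close> of the alphabet is \<open>Some a\<close>.\<close>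

record 'a classifier =
  word_emb :: "'a option \<Rightarrow> real vec"
  freqs :: "rat list"
  layers :: "layer list"
  W_out :: "real mat"
  b_out :: real

text \<open>
  Entries \<open>2j\<close> and \<open>2j + 1\<close> (0-based) are the sine and cosine of the \<open>j\<close>-th frequency.
\<close>

definition pos_enc :: "rat list \<Rightarrow> nat \<Rightarrow> real vec" where
  "pos_enc \<xi>s p = vec (2 * length \<xi>s) (\<lambda>i.
     (if even i then sin else cos) (2 * pi * of_rat (\<xi>s ! (i div 2)) * real p))"

definition wf_classifier :: "'a set \<Rightarrow> nat \<Rightarrow> 'a classifier \<Rightarrow> bool" where
  "wf_classifier \<Sigma> d T \<longleftrightarrow>
     d > 0 \<and>
     (\<forall>a \<in> insert None (Some ` \<Sigma>). word_emb T a \<in> carrier_vec d) \<and>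
     2 * length (freqs T) = d \<and>
     (\<forall>l \<in> set (layers T). wf_layer d l) \<and>
     W_out T \<in> carrier_mat 1 d"

definition input_matrix :: "nat \<Rightarrow> 'a classifier \<Rightarrow> 'a list \<Rightarrow> real mat" where
  "input_matrix d T w = mat_of_cols d
     (map (\<lambda>p. word_emb T ((None # map Some w) ! p) + pos_enc (freqs T) p) [0..<length w + 1])"

definition encode :: "nat \<Rightarrow> 'a classifier \<Rightarrow> 'a list \<Rightarrow> real mat" where
  "encode d T w = stack_apply (layers T) (input_matrix d T w)"

definition sigmoid :: "real \<Rightarrow> real" where
  "sigmoid x = 1 / (1 + exp (- x))"

definition classify :: "nat \<Rightarrow> 'a classifier \<Rightarrow> 'a list \<Rightarrow> real" where
  "classify d T w = sigmoid ((W_out T *\<^sub>v col (encode d T w) 0) $ 0 + b_out T)"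

definition accepts :: "nat \<Rightarrow> 'a classifier \<Rightarrow> 'a list \<Rightarrow> bool" where
  "accepts d T w \<longleftrightarrow> classify d T w \<ge> 1 / 2"

definition transformer_recognizable :: "'a set \<Rightarrow> 'a list set \<Rightarrow> bool" where
  "transformer_recognizable \<Sigma> L \<longleftrightarrow>
     (\<exists>d T. wf_classifier \<Sigma> d T \<and> L = {w \<in> lists \<Sigma>. accepts d T w})"

end

theory Submission
  imports Defs
begin

text \<open>
  No atom of the logic relates two positions, so a formula sees a position only through its type, the
  pair of its letter and its residue modulo the product \<open>M\<close> of all moduli.  For fixed types of the
  free positions, a counting quantifier asserts a linear equation between count variables and the
  numbers \<open>N\<^sub>k\<close> of positions of type \<open>k\<close>; quantifier elimination for linear orders of rationals then
  turns a sentence into a Boolean combination of linear inequalities in the \<open>N\<^sub>k\<close>.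

  A transformer obtains \<open>N\<^sub>k / (n + 1)\<close> and \<open>1 / (n + 1)\<close> by uniform attention.  Since the \<open>N\<^sub>k\<close> are
  integers, the strict inequalities can be shifted by half a unit so that the two sides never agree;
  then negation becomes a change of sign and conjunction a minimum, both computable with ReLUs.
\<close>

section \<open>Quantifier elimination\<close>

inductive affine :: "(('v \<Rightarrow> rat) \<Rightarrow> rat) \<Rightarrow> bool" where
  affine_const: "affine (\<lambda>_. c)"
| affine_var: "affine (\<lambda>e. e v)"
| affine_add: "affine s \<Longrightarrow> affine t \<Longrightarrow> affine (\<lambda>e. s e + t e)"
| affine_scale: "affine t \<Longrightarrow> affine (\<lambda>e. c * t e)"

text \<open>Strict positivity is the only atom and there are no quantifiers, so inductions have
  three cases; equality and disjunction are derived.\<close>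

inductive semilinear :: "(('v \<Rightarrow> rat) \<Rightarrow> bool) \<Rightarrow> bool" where
  semilinear_pos: "affine t \<Longrightarrow> semilinear (\<lambda>e. 0 < t e)"
| semilinear_not: "semilinear P \<Longrightarrow> semilinear (\<lambda>e. \<not> P e)"
| semilinear_conj: "semilinear P \<Longrightarrow> semilinear Q \<Longrightarrow> semilinear (\<lambda>e. P e \<and> Q e)"

lemma affine_diff:
  assumes "affine s" "affine t"
  shows "affine (\<lambda>e. s e - t e)"
  using affine_add[OF assms(1) affine_scale[OF assms(2), of "-1"]] by simp

text \<open>Only finitely many rational coefficients occur, so they have a common denominator. At
  integer points the values then lie in a discrete set, which later leaves room for shifting strict
  inequalities.\<close>

lemma affine_denominator:
  assumes "affine t"
  shows "\<exists>D :: int. 0 < D \<and> (\<forall>e. (\<forall>v. e v \<in> \<int>) \<longrightarrow> of_int D * t e \<in> \<int>)"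
  using assms
proof (induction rule: affine.induct)
  case (affine_const c)
  obtain n d where "c = of_int n / of_int d" "0 < d"
    by (metis quotient_of_denom_pos quotient_of_div surj_pair)
  then show ?case by (intro exI[of _ d]) simp
next
  case (affine_var v)
  show ?case by (intro exI[of _ 1]) simp
next
  case (affine_add s t)
  then obtain C D :: int where C: "0 < C" "\<forall>e. (\<forall>v. e v \<in> \<int>) \<longrightarrow> of_int C * s e \<in> \<int>"
    and D: "0 < D" "\<forall>e. (\<forall>v. e v \<in> \<int>) \<longrightarrow> of_int D * t e \<in> \<int>"
    by blast
  have "of_int (C * D) * (s e + t e) \<in> \<int>" if "\<forall>v. e v \<in> \<int>" for e
  proof -
    have ints: "of_int C * s e \<in> \<int>" "of_int D * t e \<in> \<int>" using C(2) D(2) that by simp_all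
    have "of_int (C * D) * (s e + t e) = of_int D * (of_int C * s e) + of_int C * (of_int D * t e)"
      by (simp add: algebra_simps)
    also have "\<dots> \<in> \<int>" by (intro Ints_add; rule Ints_mult[OF Ints_of_int]; fact ints)
    finally show ?thesis .
  qed
  then show ?case using C(1) D(1) by (intro exI[of _ "C * D"]) simp
next
  case (affine_scale t c)
  then obtain D :: int where D: "0 < D" "\<forall>e. (\<forall>v. e v \<in> \<int>) \<longrightarrow> of_int D * t e \<in> \<int>"
    by blast
  obtain n d where c: "c = of_int n / of_int d" "0 < d"
    by (metis quotient_of_denom_pos quotient_of_div surj_pair)
  have "of_int (d * D) * (c * t e) \<in> \<int>" if "\<forall>v. e v \<in> \<int>" for e
  proof -
    have "of_int (d * D) * (c * t e) = of_int n * (of_int D * t e)"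
      using c by (simp add: field_simps)
    also have "\<dots> \<in> \<int>" by (rule Ints_mult[OF Ints_of_int]) (use D(2) that in simp)
    finally show ?thesis .
  qed
  then show ?case using D(1) c(2) by (intro exI[of _ "d * D"]) simp
qed

lemma affine_subst:
  assumes "affine t" "affine s"
  shows "affine (\<lambda>e. t (e(v := s e)))"
  using assms
proof (induction rule: affine.induct)
  case (affine_var w)
  then show ?case by (cases "w = v") (auto intro: affine.intros)
qed (auto intro: affine.intros)

text \<open>This isolates the coefficient of the variable to be eliminated. The remainder
  \<open>s\<close> does not depend on \<open>v\<close>, as \<open>c = 0\<close> gives
  \<open>s e = t (e(v := 0))\<close>.\<close>

lemma affine_split_var:
  assumes "affine t"
  shows "\<exists>a s. affine s \<and> (\<forall>e c. t (e(v := c)) = a * c + s e)"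
  using assms
proof (induction rule: affine.induct)
  case (affine_const c)
  show ?case by (intro exI[of _ 0] exI[of _ "\<lambda>_. c"]) (auto intro: affine.intros)
next
  case (affine_var w)
  show ?case
  proof (cases "w = v")
    case True
    then show ?thesis
      by (intro exI[of _ 1] exI[of _ "\<lambda>_. 0"]) (auto intro: affine.intros)
  next
    case False
    then show ?thesis
      by (intro exI[of _ 0] exI[of _ "\<lambda>e. e w"]) (auto intro: affine.intros)
  qed
next
  case (affine_add t1 t2)
  then obtain a1 s1 a2 s2 where
    "affine s1" "\<forall>e c. t1 (e(v := c)) = a1 * c + s1 e"
    "affine s2" "\<forall>e c. t2 (e(v := c)) = a2 * c + s2 e" by blast
  then show ?case
    by (intro exI[of _ "a1 + a2"] exI[of _ "\<lambda>e. s1 e + s2 e"])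
      (auto intro: affine.intros simp: algebra_simps simp del: fun_upd_apply)
next
  case (affine_scale t1 c)
  then obtain a1 s1 where "affine s1" "\<forall>e c. t1 (e(v := c)) = a1 * c + s1 e" by blast
  then show ?case
    by (intro exI[of _ "c * a1"] exI[of _ "\<lambda>e. c * s1 e"])
      (auto intro: affine.intros simp: algebra_simps simp del: fun_upd_apply)
qed

lemma semilinear_disj:
  assumes "semilinear P" "semilinear Q"
  shows "semilinear (\<lambda>e. P e \<or> Q e)"
  using semilinear_not[OF semilinear_conj[OF semilinear_not[OF assms(1)] semilinear_not[OF assms(2)]]]
  by simp

lemma semilinear_bool: "semilinear (\<lambda>_. b)"
  using semilinear_pos[OF affine_const[of "if b then 1 else 0"]] by (cases b) simp_all

lemma semilinear_less:
  assumes "affine s" "affine t"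
  shows "semilinear (\<lambda>e. s e < t e)"
  using semilinear_pos[OF affine_diff[OF assms(2,1)]] by simp

lemma semilinear_eq:
  assumes "affine s" "affine t"
  shows "semilinear (\<lambda>e. s e = t e)"
proof -
  have "(\<lambda>e. s e = t e) = (\<lambda>e. \<not> s e < t e \<and> \<not> t e < s e)" by (auto simp: fun_eq_iff)
  then show ?thesis
    by (simp only:) (intro semilinear_conj semilinear_not semilinear_less assms)
qed

lemma semilinear_finite_disj:
  assumes "finite U" "\<And>u. u \<in> U \<Longrightarrow> semilinear (P u)"
  shows "semilinear (\<lambda>e. \<exists>u\<in>U. P u e)"
  using assms by (induction rule: finite_induct) (auto intro: semilinear_bool semilinear_disj)

lemma semilinear_subst:
  assumes "semilinear P" "affine s"
  shows "semilinear (\<lambda>e. P (e(v := s e)))"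
  using assms
  by (induction rule: semilinear.induct)
    (auto intro: semilinear.intros semilinear_pos[OF affine_subst])

section \<open>Elimination of one variable by test points\<close>

text \<open>With the other variables fixed, the truth of \<open>P\<close> can change only at the
  points \<open>r e\<close>; equal signs mean that \<open>c\<close> and \<open>c'\<close> lie on the
  same side of each of them or both on it. The points are affine functions of \<open>e\<close> so
  that they can be substituted for \<open>v\<close>.\<close>

definition breakpoints :: "'v \<Rightarrow> (('v \<Rightarrow> rat) \<Rightarrow> bool) \<Rightarrow> (('v \<Rightarrow> rat) \<Rightarrow> rat) set \<Rightarrow> bool" where
  "breakpoints v P R \<longleftrightarrow> finite R \<and> (\<forall>r\<in>R. affine r) \<and>
    (\<forall>e c c'. (\<forall>r\<in>R. sgn (c - r e) = sgn (c' - r e)) \<longrightarrow> P (e(v := c)) = P (e(v := c')))"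

lemma breakpoints_conj:
  assumes "breakpoints v P R" "breakpoints v Q S"
  shows "breakpoints v (\<lambda>e. P e \<and> Q e) (R \<union> S)"
proof -
  have PQ: "P (e(v := c)) = P (e(v := c'))" "Q (e(v := c)) = Q (e(v := c'))"
    if "\<forall>r\<in>R \<union> S. sgn (c - r e) = sgn (c' - r e)" for e c c'
    using assms that unfolding breakpoints_def ball_Un by (elim conjE; simp)+
  have "(P (e(v := c)) \<and> Q (e(v := c))) = (P (e(v := c')) \<and> Q (e(v := c')))"
    if "\<forall>r\<in>R \<union> S. sgn (c - r e) = sgn (c' - r e)" for e c c'
    using PQ[OF that] by (simp only:)
  moreover have "finite (R \<union> S)" "\<forall>r\<in>R \<union> S. affine r"
    using assms unfolding breakpoints_def ball_Un by simp_all
  ultimately show ?thesis unfolding breakpoints_def by blast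
qed

text \<open>An atom in which \<open>v\<close> has a nonzero coefficient changes only at its root;
  other atoms contribute no point, negation keeps the points and conjunction unites them.\<close>

lemma semilinear_breakpoints:
  assumes "semilinear P"
  shows "\<exists>R. breakpoints v P R"
  using assms
proof (induction rule: semilinear.induct)
  case (semilinear_pos t)
  from affine_split_var[OF semilinear_pos, of v]
  obtain a s where s: "affine s" "\<forall>e c. t (e(v := c)) = a * c + s e"
    by blast
  show ?case
  proof (cases "a = 0")
    case True
    then show ?thesis using s by (intro exI[of _ "{}"]) (simp add: breakpoints_def)
  next
    case False
    \<comment> \<open>The root in \<open>c\<close> of \<open>a * c + s e = 0\<close>.\<close>
    define r where "r e = - (1 / a) * s e" for e
    have r: "affine r" unfolding r_def[abs_def] by (intro affine_scale s)
    have "t (e(v := c)) = a * (c - r e)" for e c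
      using False by (simp add: s(2) r_def algebra_simps)
    then have "sgn (t (e(v := c))) = sgn a * sgn (c - r e)" for e c
      by (simp add: sgn_mult)
    moreover have "0 < t e \<longleftrightarrow> sgn (t e) = 1" for e
      by (simp add: sgn_1_pos)
    ultimately show ?thesis using r by (intro exI[of _ "{r}"]) (simp add: breakpoints_def)
  qed
next
  case (semilinear_not P)
  have "breakpoints v (\<lambda>e. \<not> P e) R = breakpoints v P R" for R
    unfolding breakpoints_def by simp
  then show ?case using semilinear_not.IH by simp
next
  case (semilinear_conj P Q)
  then obtain R S where "breakpoints v P R" "breakpoints v Q S" by (elim exE)
  from breakpoints_conj[OF this] show ?case by (rule exI)
qed

text \<open>The finite set \<open>R\<close> cuts the line into points and open intervals, and
  \<open>c\<close> may be moved within its piece: to the midpoint of its two neighbours, one unit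
  beyond the extreme point, or to 0 if \<open>R\<close> is empty.\<close>

lemma same_side_test_point:
  fixes R :: "rat set" and c :: rat
  assumes "finite R"
  obtains "\<forall>r\<in>R. sgn (c - r) = sgn (0 - r)"
  | r0 where "r0 \<in> R" "\<forall>r\<in>R. sgn (c - r) = sgn (r0 - 1 - r)"
  | r0 where "r0 \<in> R" "\<forall>r\<in>R. sgn (c - r) = sgn (r0 + 1 - r)"
  | r0 r1 where "r0 \<in> R" "r1 \<in> R" "\<forall>r\<in>R. sgn (c - r) = sgn ((r0 + r1) / 2 - r)"
proof -
  define l where "l = {r \<in> R. r < c}"
  define u where "u = {r \<in> R. c < r}"
  have fin: "finite l" "finite u" using assms by (auto simp: l_def u_def)
  have sgnI: "sgn (c - r) = sgn (x - r)"
    if "r < c \<Longrightarrow> r < x" "c < r \<Longrightarrow> x < r" "c = r \<Longrightarrow> x = r" for x r :: rat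
    using that by (cases r c rule: linorder_cases) auto
  consider "c \<in> R" | "c \<notin> R" "l = {}" "u = {}" | "c \<notin> R" "l = {}" "u \<noteq> {}"
    | "c \<notin> R" "l \<noteq> {}" "u = {}" | "c \<notin> R" "l \<noteq> {}" "u \<noteq> {}" by blast
  then show thesis
  proof cases
    case 1
    \<comment> \<open>A point of \<open>R\<close> is the midpoint of itself and itself.\<close>
    then show thesis using that(4)[of c c] by simp
  next
    case 2
    then have "r \<notin> R" for r by (cases r c rule: linorder_cases) (auto simp: l_def u_def)
    then show thesis using that(1) by blast
  next
    case 3
    have "\<forall>r\<in>R. sgn (c - r) = sgn (Min u - 1 - r)"
    proof
      fix r assume "r \<in> R"
      then have "r \<in> u" using 3(1,2) by (cases r c rule: linorder_cases) (auto simp: l_def u_def)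
      then have "Min u \<le> r" "c < r" using fin by (auto simp: u_def)
      then show "sgn (c - r) = sgn (Min u - 1 - r)" by (intro sgnI) auto
    qed
    moreover have "Min u \<in> R" using Min_in[OF fin(2) 3(3)] by (simp add: u_def)
    ultimately show thesis using that(2) by blast
  next
    case 4
    have "\<forall>r\<in>R. sgn (c - r) = sgn (Max l + 1 - r)"
    proof
      fix r assume "r \<in> R"
      then have "r \<in> l" using 4(1,3) by (cases r c rule: linorder_cases) (auto simp: l_def u_def)
      then have "r \<le> Max l" "r < c" using fin by (auto simp: l_def)
      then show "sgn (c - r) = sgn (Max l + 1 - r)" by (intro sgnI) auto
    qed
    moreover have "Max l \<in> R" using Max_in[OF fin(1) 4(2)] by (simp add: l_def)
    ultimately show thesis using that(3) by blast
  next
    case 5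
    have m: "Max l \<in> l" "Min u \<in> u" using 5 fin by auto
    have "\<forall>r\<in>R. sgn (c - r) = sgn ((Max l + Min u) / 2 - r)"
    proof
      fix r assume r: "r \<in> R"
      have "Max l < Min u" using m by (simp add: l_def u_def)
      moreover have "r < c \<Longrightarrow> r \<le> Max l" "c < r \<Longrightarrow> Min u \<le> r"
        using r fin by (auto simp: l_def u_def)
      ultimately show "sgn (c - r) = sgn ((Max l + Min u) / 2 - r)"
        using r 5 by (intro sgnI) (auto simp: field_simps)
    qed
    then show thesis using that(4)[of "Max l" "Min u"] m by (simp add: l_def u_def)
  qed
qed

text \<open>
  The existential quantifier is replaced by a disjunction over finitely many test points: between
  two breakpoints, beyond them, or arbitrary if there are none.
\<close>

lemma semilinear_ex:
  assumes "semilinear P"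
  shows "semilinear (\<lambda>e. \<exists>c. P (e(v := c)))"
proof -
  obtain R where R: "breakpoints v P R" using semilinear_breakpoints[OF assms] by blast
  define U where "U = {\<lambda>_. 0} \<union> (\<lambda>r e. r e + (-1)) ` R \<union> (\<lambda>r e. r e + 1) ` R
    \<union> (\<lambda>(r, r') e. (1 / 2) * (r e + r' e)) ` (R \<times> R)"
  have "finite U" using R unfolding U_def breakpoints_def by blast
  have U: "affine u" if "u \<in> U" for u
    using that R unfolding U_def breakpoints_def by safe (intro affine.intros; blast)+
  have "(\<exists>c. P (e(v := c))) \<longleftrightarrow> (\<exists>u\<in>U. P (e(v := u e)))" for e
  proof
    assume "\<exists>c. P (e(v := c))"
    then obtain c where c: "P (e(v := c))" ..
    have "\<exists>u\<in>U. \<forall>r\<in>R. sgn (c - r e) = sgn (u e - r e)"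
    proof (rule same_side_test_point[of "(\<lambda>r. r e) ` R" c])
      show "finite ((\<lambda>r. r e) ` R)" using R unfolding breakpoints_def by blast
    next
      assume "\<forall>r\<in>(\<lambda>r. r e) ` R. sgn (c - r) = sgn (0 - r)"
      then show ?thesis by (intro bexI[of _ "\<lambda>_. 0"]) (auto simp: U_def)
    next
      fix r0 assume "r0 \<in> (\<lambda>r. r e) ` R" "\<forall>r\<in>(\<lambda>r. r e) ` R. sgn (c - r) = sgn (r0 - 1 - r)"
      then obtain r where "r \<in> R" "\<forall>r'\<in>R. sgn (c - r' e) = sgn (r e - 1 - r' e)" by auto
      then show ?thesis by (intro bexI[of _ "\<lambda>e. r e + (-1)"]) (auto simp: U_def)
    next
      fix r0 assume "r0 \<in> (\<lambda>r. r e) ` R" "\<forall>r\<in>(\<lambda>r. r e) ` R. sgn (c - r) = sgn (r0 + 1 - r)"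
      then obtain r where "r \<in> R" "\<forall>r'\<in>R. sgn (c - r' e) = sgn (r e + 1 - r' e)" by auto
      then show ?thesis by (intro bexI[of _ "\<lambda>e. r e + 1"]) (auto simp: U_def)
    next
      fix r0 r1 assume "r0 \<in> (\<lambda>r. r e) ` R" "r1 \<in> (\<lambda>r. r e) ` R"
        "\<forall>r\<in>(\<lambda>r. r e) ` R. sgn (c - r) = sgn ((r0 + r1) / 2 - r)"
      then obtain r s where "r \<in> R" "s \<in> R"
        "\<forall>r'\<in>R. sgn (c - r' e) = sgn ((r e + s e) / 2 - r' e)" by auto
      then show ?thesis
        by (intro bexI[of _ "\<lambda>e. (1 / 2) * (r e + s e)"]) (auto simp: U_def)
    qed
    then obtain u where "u \<in> U" "\<forall>r\<in>R. sgn (c - r e) = sgn (u e - r e)" by blast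
    then have "u \<in> U" "P (e(v := c)) = P (e(v := u e))" using R unfolding breakpoints_def by blast+
    then show "\<exists>u\<in>U. P (e(v := u e))" using c by blast
  qed auto
  moreover have "semilinear (\<lambda>e. \<exists>u\<in>U. P (e(v := u e)))"
    using U \<open>finite U\<close> by (intro semilinear_finite_disj semilinear_subst assms)
  ultimately show ?thesis by simp
qed

text \<open>A case distinction on \<open>P k\<close> moves the summand \<open>s k\<close> into
  \<open>t\<close>, which is why \<open>t\<close> is arbitrary in the induction. Counting
  quantifiers lead to such equations: a type contributes its count exactly if it satisfies the
  counted formula.\<close>

lemma semilinear_conditional_sum_eq:
  assumes "finite K" "\<And>k. k \<in> K \<Longrightarrow> semilinear (P k)" "\<And>k. k \<in> K \<Longrightarrow> affine (s k)" "affine t"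
  shows "semilinear (\<lambda>e. t e + (\<Sum>k\<in>K. if P k e then s k e else 0) = 0)"
  using assms
proof (induction K arbitrary: t rule: finite_induct)
  case empty
  then show ?case by (auto intro: semilinear_eq affine_const)
next
  case (insert k K)
  let ?S = "\<lambda>e. \<Sum>k\<in>K. if P k e then s k e else 0"
  have "(\<lambda>e. t e + (\<Sum>k\<in>insert k K. if P k e then s k e else 0) = 0) =
    (\<lambda>e. (P k e \<and> (t e + s k e) + ?S e = 0) \<or> (\<not> P k e \<and> t e + ?S e = 0))"
    using insert.hyps by (auto simp: fun_eq_iff add.assoc)
  moreover have "semilinear (\<lambda>e. (t e + s k e) + ?S e = 0)"
    using insert.prems by (intro insert.IH affine_add) auto
  moreover have "semilinear (\<lambda>e. t e + ?S e = 0)"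
    using insert.prems by (intro insert.IH) auto
  ultimately show ?case
    using insert.prems(1)[of k] by (auto intro!: semilinear_disj semilinear_conj semilinear_not)
qed


section \<open>Formulas as semilinear conditions on counts\<close>

fun modulus :: "'a formula \<Rightarrow> nat" where
  "modulus (Mod r m p) = m"
| "modulus (And \<phi> \<psi>) = modulus \<phi> * modulus \<psi>"
| "modulus (Or \<phi> \<psi>) = modulus \<phi> * modulus \<psi>"
| "modulus (Neg \<phi>) = modulus \<phi>"
| "modulus (Exists x \<phi>) = modulus \<phi>"
| "modulus (Forall x \<phi>) = modulus \<phi>"
| "modulus (ExCount x p \<phi>) = modulus \<phi>"
| "modulus _ = 1"

lemma modulus_pos: "wf_formula \<Sigma> \<phi> \<Longrightarrow> 0 < modulus \<phi>"
  by (induction \<phi>) auto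

definition pos_type :: "nat \<Rightarrow> 'a list \<Rightarrow> nat \<Rightarrow> 'a \<times> nat" where
  "pos_type M w i = (w ! (i - 1), i mod M)"

definition type_count :: "nat \<Rightarrow> 'a list \<Rightarrow> 'a \<times> nat \<Rightarrow> nat" where
  "type_count M w k = card {i \<in> {1..length w}. pos_type M w i = k}"

text \<open>Count variables and type counts share one variable space: quantifiers eliminate an
  \<open>Inl x\<close> while the counts \<open>Inr k\<close> remain as parameters.\<close>

definition env :: "nat \<Rightarrow> 'a list \<Rightarrow> (cvar \<Rightarrow> rat) \<Rightarrow> cvar + 'a \<times> nat \<Rightarrow> rat" where
  "env M w \<beta> = case_sum \<beta> (\<lambda>k. of_nat (type_count M w k))"

lemma env_simps [simp]:
  "env M w \<beta> (Inl x) = \<beta> x"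
  "env M w \<beta> (Inr k) = of_nat (type_count M w k)"
  by (simp_all add: env_def)

lemma env_upd: "env M w (\<beta>(x := c)) = (env M w \<beta>)(Inl x := c)"
  by (auto simp: env_def fun_eq_iff split: sum.split)

lemma affine_cterm_val:
  "\<exists>u. affine u \<and> (\<forall>M (w :: 'a list) \<beta>. cterm_val \<beta> t = u (env M w \<beta>))"
proof (cases t)
  case (CTerm c0 cs)
  have "\<exists>u. affine u \<and> (\<forall>M (w :: 'a list) \<beta>. (\<Sum>(c, x)\<leftarrow>cs. c * \<beta> x) = u (env M w \<beta>))"
  proof (induction cs)
    case Nil
    show ?case by (intro exI[of _ "\<lambda>_. 0"]) (auto intro: affine_const)
  next
    case (Cons a cs)
    obtain c x where a: "a = (c, x)" by fastforce
    from Cons obtain u where "affine u" "\<forall>M (w :: 'a list) \<beta>. (\<Sum>(c, x)\<leftarrow>cs. c * \<beta> x) = u (env M w \<beta>)"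
      by blast
    then show ?case
      by (intro exI[of _ "\<lambda>e. c * e (Inl x) + u e"] conjI affine_add affine_scale affine_var)
        (simp_all add: a)
  qed
  then obtain u where "affine u" "\<forall>M (w :: 'a list) \<beta>. (\<Sum>(c, x)\<leftarrow>cs. c * \<beta> x) = u (env M w \<beta>)" by blast
  then show ?thesis
    by (intro exI[of _ "\<lambda>e. c0 + u e"]) (auto simp: CTerm intro: affine.intros)
qed

lemma pos_type_in:
  assumes "w \<in> lists \<Sigma>" "0 < M" "i \<in> {1..length w}"
  shows "pos_type M w i \<in> \<Sigma> \<times> {..<M}"
proof -
  have "w ! (i - 1) \<in> set w" using assms(3) by (intro nth_mem) auto
  then show ?thesis using assms(1,2) by (auto simp: pos_type_def in_lists_conv_set)
qed

text \<open>Every position has a type in \<open>\<Sigma> \<times> {..<M}\<close>, so the counted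
  positions split into the disjoint classes of those types that satisfy \<open>T\<close>.\<close>

lemma card_by_type:
  assumes "finite \<Sigma>" "w \<in> lists \<Sigma>" "0 < M"
    and "\<And>i. i \<in> {1..length w} \<Longrightarrow> S i \<longleftrightarrow> T (pos_type M w i)"
  shows "card {i \<in> {1..length w}. S i} = (\<Sum>k\<in>\<Sigma> \<times> {..<M}. if T k then type_count M w k else 0)"
proof -
  let ?K = "{k \<in> \<Sigma> \<times> {..<M}. T k}"
  have "pos_type M w i \<in> \<Sigma> \<times> {..<M}" if "i \<in> {1..length w}" for i
    using pos_type_in[OF assms(2,3) that] .
  then have "{i \<in> {1..length w}. S i} = (\<Union>k\<in>?K. {i \<in> {1..length w}. pos_type M w i = k})"
    using assms(4) by auto
  also have "card \<dots> = (\<Sum>k\<in>?K. type_count M w k)"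
    unfolding type_count_def using assms(1) by (intro card_UN_disjoint) auto
  also have "\<dots> = (\<Sum>k\<in>\<Sigma> \<times> {..<M}. if T k then type_count M w k else 0)"
    using assms(1) by (simp add: sum.If_cases Int_def)
  finally show ?thesis .
qed

text \<open>Once the types \<open>\<tau>\<close> of the free positions are fixed, the letter and
  residue atoms are constants; \<open>P\<close> depends on \<open>\<tau>\<close> but not on the word
  or the assignments. One \<open>M\<close> serves all subformulas, hence divisibility instead of
  equality.\<close>

lemma formula_semilinear:
  assumes "finite \<Sigma>" "0 < M" "modulus \<phi> dvd M"
  shows "\<exists>P. semilinear P \<and> (\<forall>w\<in>lists \<Sigma>. \<forall>\<alpha> \<beta>. (\<forall>p\<in>free_pvars \<phi>. pos_type M w (\<alpha> p) = \<tau> p)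
    \<longrightarrow> (sat w \<alpha> \<beta> \<phi> \<longleftrightarrow> P (env M w \<beta>)))"
  using assms(3)
proof (induction \<phi> arbitrary: \<tau>)
  case Top
  then show ?case by (intro exI[of _ "\<lambda>_. True"]) (simp add: semilinear_bool)
next
  case Bot
  then show ?case by (intro exI[of _ "\<lambda>_. False"]) (simp add: semilinear_bool)
next
  case (Letter a p)
  then show ?case
    by (intro exI[of _ "\<lambda>_. fst (\<tau> p) = a"]) (auto simp: semilinear_bool pos_type_def prod_eq_iff)
next
  case (Mod r m p)
  \<comment> \<open>As \<open>m\<close> divides \<open>M\<close>, the residue recorded in the type
    determines the residue modulo \<open>m\<close>.\<close>
  then have "i mod m = i mod M mod m" for i by (simp add: mod_mod_cancel)
  then have "i mod m = snd (\<tau> p) mod m" if "pos_type M w i = \<tau> p" for w :: "'a list" and i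
    using that by (metis pos_type_def snd_conv)
  then show ?case
    by (intro exI[of _ "\<lambda>_. snd (\<tau> p) mod m = r mod m"]) (simp add: semilinear_bool)
next
  case (Eq s t)
  obtain u1 u2 where "affine u1" "\<forall>(M::nat) (w::'a list) \<beta>. cterm_val \<beta> s = u1 (env M w \<beta>)"
    "affine u2" "\<forall>(M::nat) (w::'a list) \<beta>. cterm_val \<beta> t = u2 (env M w \<beta>)"
    using affine_cterm_val by metis
  then show ?case by (intro exI[of _ "\<lambda>e. u1 e = u2 e"]) (simp add: semilinear_eq)
next
  case (Less s t)
  obtain u1 u2 where "affine u1" "\<forall>(M::nat) (w::'a list) \<beta>. cterm_val \<beta> s = u1 (env M w \<beta>)"
    "affine u2" "\<forall>(M::nat) (w::'a list) \<beta>. cterm_val \<beta> t = u2 (env M w \<beta>)"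
    using affine_cterm_val by metis
  then show ?case by (intro exI[of _ "\<lambda>e. u1 e < u2 e"]) (simp add: semilinear_less)
next
  case (And \<phi> \<psi>)
  have "modulus \<phi> dvd M" "modulus \<psi> dvd M" using And.prems by (auto elim: dvd_mult_left dvd_mult_right)
  from And.IH(1)[OF this(1), of \<tau>] And.IH(2)[OF this(2), of \<tau>] obtain P Q where
    "semilinear P" "\<forall>w\<in>lists \<Sigma>. \<forall>\<alpha> \<beta>. (\<forall>p\<in>free_pvars \<phi>. pos_type M w (\<alpha> p) = \<tau> p)
      \<longrightarrow> (sat w \<alpha> \<beta> \<phi> \<longleftrightarrow> P (env M w \<beta>))"
    "semilinear Q" "\<forall>w\<in>lists \<Sigma>. \<forall>\<alpha> \<beta>. (\<forall>p\<in>free_pvars \<psi>. pos_type M w (\<alpha> p) = \<tau> p)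
      \<longrightarrow> (sat w \<alpha> \<beta> \<psi> \<longleftrightarrow> Q (env M w \<beta>))" by auto
  then show ?case
    by (intro exI[of _ "\<lambda>e. P e \<and> Q e"]) (simp add: semilinear_conj)
next
  case (Or \<phi> \<psi>)
  have "modulus \<phi> dvd M" "modulus \<psi> dvd M" using Or.prems by (auto elim: dvd_mult_left dvd_mult_right)
  from Or.IH(1)[OF this(1), of \<tau>] Or.IH(2)[OF this(2), of \<tau>] obtain P Q where
    "semilinear P" "\<forall>w\<in>lists \<Sigma>. \<forall>\<alpha> \<beta>. (\<forall>p\<in>free_pvars \<phi>. pos_type M w (\<alpha> p) = \<tau> p)
      \<longrightarrow> (sat w \<alpha> \<beta> \<phi> \<longleftrightarrow> P (env M w \<beta>))"
    "semilinear Q" "\<forall>w\<in>lists \<Sigma>. \<forall>\<alpha> \<beta>. (\<forall>p\<in>free_pvars \<psi>. pos_type M w (\<alpha> p) = \<tau> p)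
      \<longrightarrow> (sat w \<alpha> \<beta> \<psi> \<longleftrightarrow> Q (env M w \<beta>))" by auto
  then show ?case
    by (intro exI[of _ "\<lambda>e. P e \<or> Q e"]) (simp add: semilinear_disj)
next
  case (Neg \<phi>)
  from Neg.IH[of \<tau>] Neg.prems obtain P where P: "semilinear P" "\<forall>w\<in>lists \<Sigma>. \<forall>\<alpha> \<beta>.
      (\<forall>p\<in>free_pvars \<phi>. pos_type M w (\<alpha> p) = \<tau> p) \<longrightarrow> (sat w \<alpha> \<beta> \<phi> \<longleftrightarrow> P (env M w \<beta>))"
    by auto
  then show ?case by (intro exI[of _ "\<lambda>e. \<not> P e"]) (simp add: semilinear_not)
next
  case (Exists x \<phi>)
  from Exists.IH[of \<tau>] Exists.prems obtain P where P: "semilinear P" "\<forall>w\<in>lists \<Sigma>. \<forall>\<alpha> \<beta>.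
      (\<forall>p\<in>free_pvars \<phi>. pos_type M w (\<alpha> p) = \<tau> p) \<longrightarrow> (sat w \<alpha> \<beta> \<phi> \<longleftrightarrow> P (env M w \<beta>))"
    by auto
  then show ?case
    by (intro exI[of _ "\<lambda>e. \<exists>c. P (e(Inl x := c))"]) (simp add: semilinear_ex env_upd)
next
  case (Forall x \<phi>)
  from Forall.IH[of \<tau>] Forall.prems obtain P where P: "semilinear P" "\<forall>w\<in>lists \<Sigma>. \<forall>\<alpha> \<beta>.
      (\<forall>p\<in>free_pvars \<phi>. pos_type M w (\<alpha> p) = \<tau> p) \<longrightarrow> (sat w \<alpha> \<beta> \<phi> \<longleftrightarrow> P (env M w \<beta>))"
    by auto
  have "semilinear (\<lambda>e. \<not> (\<exists>c. \<not> P (e(Inl x := c))))"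
    using P(1) by (intro semilinear_not semilinear_ex)
  then show ?case
    using P by (intro exI[of _ "\<lambda>e. \<not> (\<exists>c. \<not> P (e(Inl x := c)))"]) (simp add: env_upd)
next
  case (ExCount x p \<phi>)
  \<comment> \<open>One condition for each type \<open>k\<close> that the bound position may
    have.\<close>
  then have "\<forall>k. \<exists>P. semilinear P \<and> (\<forall>w\<in>lists \<Sigma>. \<forall>\<alpha> \<beta>.
      (\<forall>q\<in>free_pvars \<phi>. pos_type M w (\<alpha> q) = (\<tau>(p := k)) q)
      \<longrightarrow> (sat w \<alpha> \<beta> \<phi> \<longleftrightarrow> P (env M w \<beta>)))" by simp
  from choice[OF this] obtain P where P: "\<And>k. semilinear (P k)"
    "\<And>k w \<alpha> \<beta>. w \<in> lists \<Sigma> \<Longrightarrow> \<forall>q\<in>free_pvars \<phi>. pos_type M w (\<alpha> q) = (\<tau>(p := k)) q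
      \<Longrightarrow> sat w \<alpha> \<beta> \<phi> \<longleftrightarrow> P k (env M w \<beta>)" by blast
  let ?S = "\<lambda>e. \<Sum>k\<in>\<Sigma> \<times> {..<M}. if P k e then e (Inr k) else 0"
  \<comment> \<open>The counting assertion as a linear equation: the counts of the satisfying types
    add up to \<open>x\<close>.\<close>
  have "semilinear (\<lambda>e. (-1) * e (Inl x) + ?S e = 0)"
    using P(1) assms(1) by (intro semilinear_conditional_sum_eq affine.intros) auto
  moreover have "sat w \<alpha> \<beta> (ExCount x p \<phi>) \<longleftrightarrow> (-1) * env M w \<beta> (Inl x) + ?S (env M w \<beta>) = 0"
    if w: "w \<in> lists \<Sigma>" and \<alpha>: "\<forall>q\<in>free_pvars (ExCount x p \<phi>). pos_type M w (\<alpha> q) = \<tau> q"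
    for w \<alpha> \<beta>
  proof -
    have "sat w (\<alpha>(p := i)) \<beta> \<phi> \<longleftrightarrow> P (pos_type M w i) (env M w \<beta>)" for i
      using \<alpha> by (intro P(2) w) auto
    then have "card {i \<in> {1..length w}. sat w (\<alpha>(p := i)) \<beta> \<phi>} =
      (\<Sum>k\<in>\<Sigma> \<times> {..<M}. if P k (env M w \<beta>) then type_count M w k else 0)"
      by (intro card_by_type assms w) simp
    then have "(of_nat (card {i \<in> {1..length w}. sat w (\<alpha>(p := i)) \<beta> \<phi>}) :: rat) =
      ?S (env M w \<beta>)"
      by (simp add: if_distrib cong: if_cong)
    then show ?thesis by auto
  qed
  ultimately show ?case by blast
qed


section \<open>A register machine compiled to transformer layers\<close>

type_synonym lincomb = "(real \<times> nat) list"

definition lincomb :: "lincomb \<Rightarrow> (nat \<Rightarrow> real) \<Rightarrow> real" where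
  "lincomb u x = (\<Sum>(c, i)\<leftarrow>u. c * x i)"

lemma lincomb_simps [simp]:
  "lincomb [] x = 0"
  "lincomb ((c, i) # u) x = c * x i + lincomb u x"
  "lincomb (u @ v) x = lincomb u x + lincomb v x"
  by (simp_all add: lincomb_def)

lemma lincomb_map_scale: "lincomb (map (\<lambda>(c, i). (a * c, i)) u) x = a * lincomb u x"
  by (induction u) (auto simp: algebra_simps)

lemma lincomb_cong: "(\<And>i. i \<in> snd ` set u \<Longrightarrow> x i = y i) \<Longrightarrow> lincomb u x = lincomb u y"
  by (induction u) auto

text \<open>An index may occur several times in the list, so its coefficients are added up; the
  result is a row of a weight matrix.\<close>

definition coeff_of :: "lincomb \<Rightarrow> nat \<Rightarrow> real" where
  "coeff_of u j = (\<Sum>(c, i)\<leftarrow>u. if i = j then c else 0)"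

lemma sum_coeff_of:
  assumes "snd ` set u \<subseteq> {..<d}"
  shows "(\<Sum>j<d. coeff_of u j * x j) = lincomb u x"
  using assms
proof (induction u)
  case Nil
  then show ?case by (simp add: coeff_of_def)
next
  case (Cons a u)
  obtain c i where a: "a = (c, i)" by fastforce
  have "(\<Sum>j<d. coeff_of (a # u) j * x j) =
    (\<Sum>j<d. (if i = j then c * x j else 0) + coeff_of u j * x j)"
    by (intro sum.cong) (auto simp: coeff_of_def a algebra_simps)
  also have "\<dots> = c * x i + (\<Sum>j<d. coeff_of u j * x j)"
    using Cons.prems by (simp add: sum.distrib a)
  finally show ?case using Cons by (simp add: a)
qed

text \<open>
  The argument \<open>n\<close> of \<open>exec\<close> is the number of columns; a state maps a column and a register to the
  value stored there.
\<close>

datatype instr = Relu nat lincomb | Avg nat lincomb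

fun target :: "instr \<Rightarrow> nat" where
  "target (Relu i u) = i"
| "target (Avg i u) = i"

fun operands :: "instr \<Rightarrow> nat set" where
  "operands (Relu i u) = snd ` set u"
| "operands (Avg i u) = snd ` set u"

text \<open>Both instructions add to their target because of the residual connections; a register
  holding 0 is thereby assigned.\<close>

fun exec :: "nat \<Rightarrow> instr \<Rightarrow> (nat \<Rightarrow> nat \<Rightarrow> real) \<Rightarrow> nat \<Rightarrow> nat \<Rightarrow> real" where
  "exec n (Relu i u) x = (\<lambda>q. (x q)(i := x q i + max 0 (lincomb u (x q))))"
| "exec n (Avg i u) x = (\<lambda>q. (x q)(i := x q i + (\<Sum>p<n. lincomb u (x p)) / real n))"

section \<open>Compilation of instructions into layers\<close>

text \<open>Zero queries and keys make all scores 0, so all columns get the same weight and the head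
  computes an average.\<close>

definition uniform_attention :: "nat \<Rightarrow> real mat \<Rightarrow> attention" where
  "uniform_attention d V = \<lparr>WQ = 0\<^sub>m 1 d, WK = 0\<^sub>m 1 d, WV = V\<rparr>"

text \<open>Each instruction uses one half of a layer and silences the other with zero matrices.
  Output is written to row \<open>i\<close> only, so the residual connection preserves all other
  registers.\<close>

fun compile :: "nat \<Rightarrow> instr \<Rightarrow> layer" where
  "compile d (Relu i u) =
     \<lparr>heads = [uniform_attention d (0\<^sub>m d d)],
      feed_forward = \<lparr>ff_W1 = mat 1 d (\<lambda>(_, j). coeff_of u j), ff_b1 = 0\<^sub>v 1,
        ff_W2 = mat d 1 (\<lambda>(k, _). if k = i then 1 else 0), ff_b2 = 0\<^sub>v d\<rparr>\<rparr>"
| "compile d (Avg i u) =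
     \<lparr>heads = [uniform_attention d (mat d d (\<lambda>(k, j). if k = i then coeff_of u j else 0))],
      feed_forward = \<lparr>ff_W1 = 0\<^sub>m 1 d, ff_b1 = 0\<^sub>v 1, ff_W2 = 0\<^sub>m d 1, ff_b2 = 0\<^sub>v d\<rparr>\<rparr>"

lemma wf_layer_compile: "wf_layer d (compile d ins)"
proof -
  have "wf_attention d (uniform_attention d V)" if "V \<in> carrier_mat d d" for V
    using that unfolding wf_attention_def uniform_attention_def by (intro exI[of _ 1]) simp
  then show ?thesis
    by (cases ins) (auto simp: wf_layer_def wf_ffn_def intro!: exI[of _ 1])
qed

lemma self_attention_uniform:
  assumes "A \<in> carrier_mat d n"
  shows "self_attention (uniform_attention d V) A =
    mat d n (\<lambda>(i, q). (\<Sum>p<n. (V *\<^sub>v col A p) $ i) / real n)"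
proof -
  have "att_score (uniform_attention d V) A q p = 0" for q p
    using assms by (simp add: att_score_def uniform_attention_def scalar_prod_def)
  then show ?thesis
    using assms by (simp add: self_attention_def uniform_attention_def)
qed

lemma layer_apply_uniform:
  assumes "A \<in> carrier_mat d n" "heads l = [uniform_attention d V]"
    and "\<And>x. ffn_apply (feed_forward l) x \<in> carrier_vec d"
  defines "A' \<equiv> self_attention (uniform_attention d V) A + A"
  shows "layer_apply l A \<in> carrier_mat d n"
    and "i < d \<Longrightarrow> q < n \<Longrightarrow>
      layer_apply l A $$ (i, q) = ffn_apply (feed_forward l) (col A' q) $ i + A' $$ (i, q)"
proof -
  have A': "A' \<in> carrier_mat d n" using assms(1) by (simp add: A'_def)
  have l: "layer_apply l A = ffn_columnwise (feed_forward l) A' + A'"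
    by (simp add: layer_apply_def assms(2) A'_def Let_def)
  show "layer_apply l A \<in> carrier_mat d n"
    using A' by (simp add: l)
  show "i < d \<Longrightarrow> q < n \<Longrightarrow>
      layer_apply l A $$ (i, q) = ffn_apply (feed_forward l) (col A' q) $ i + A' $$ (i, q)"
    using A' assms(3) by (simp add: l ffn_columnwise_def mat_of_cols_index)
qed

definition represents :: "nat \<Rightarrow> nat \<Rightarrow> real mat \<Rightarrow> (nat \<Rightarrow> nat \<Rightarrow> real) \<Rightarrow> bool" where
  "represents d n A x \<longleftrightarrow> A \<in> carrier_mat d n \<and> (\<forall>q<n. \<forall>i<d. A $$ (i, q) = x q i)"

lemma scalar_prod_coeff_of:
  assumes "snd ` set u \<subseteq> {..<d}" "dim_vec v = d" "\<And>j. j < d \<Longrightarrow> v $ j = x j"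
  shows "vec d (coeff_of u) \<bullet> v = lincomb u x"
proof -
  have "vec d (coeff_of u) \<bullet> v = (\<Sum>j<d. coeff_of u j * x j)"
    using assms(2,3) by (auto simp: scalar_prod_def atLeast0LessThan intro!: sum.cong)
  then show ?thesis using sum_coeff_of[OF assms(1)] by simp
qed

lemma represents_compile:
  assumes "represents d n A x" "target ins < d" "operands ins \<subseteq> {..<d}"
  shows "represents d n (layer_apply (compile d ins) A) (exec n ins x)"
proof -
  have A: "A \<in> carrier_mat d n" and x: "\<And>q i. q < n \<Longrightarrow> i < d \<Longrightarrow> A $$ (i, q) = x q i"
    using assms(1) by (auto simp: represents_def)
  show ?thesis
  proof (cases ins)
    case (Relu i u)
    let ?l = "compile d ins"
    have "self_attention (uniform_attention d (0\<^sub>m d d)) A = 0\<^sub>m d n"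
      using A by (auto simp: self_attention_uniform scalar_prod_def)
    then have A': "self_attention (uniform_attention d (0\<^sub>m d d)) A + A = A"
      using A by simp
    have row: "row (mat 1 d (\<lambda>(_, j). coeff_of u j)) 0 = vec d (coeff_of u)"
      by (auto simp: row_def)
    have h: "heads ?l = [uniform_attention d (0\<^sub>m d d)]" by (simp add: Relu)
    have c: "ffn_apply (feed_forward ?l) v \<in> carrier_vec d" for v
      by (rule carrier_vecI) (simp add: ffn_apply_def Relu)
    have "ffn_apply (feed_forward ?l) (col A q) $ k = (if k = i then max 0 (lincomb u (x q)) else 0)"
      if "k < d" "q < n" for k q
    proof -
      have "vec d (coeff_of u) \<bullet> col A q = lincomb u (x q)"
        using assms(3) A x that by (intro scalar_prod_coeff_of) (auto simp: Relu)
      then have "mat 1 d (\<lambda>(_, j). coeff_of u j) *\<^sub>v col A q + 0\<^sub>v 1 =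
          vec 1 (\<lambda>_. lincomb u (x q))"
        using row by (intro eq_vecI) simp_all
      then show ?thesis
        using that by (simp add: ffn_apply_def Relu scalar_prod_def)
    qed
    then show ?thesis
      using layer_apply_uniform[OF A h c] x unfolding A' by (simp add: represents_def Relu)
  next
    case (Avg i u)
    let ?l = "compile d ins" and ?V = "mat d d (\<lambda>(k, j). if k = i then coeff_of u j else 0)"
    let ?A' = "self_attention (uniform_attention d ?V) A + A"
    have h: "heads ?l = [uniform_attention d ?V]" by (simp add: Avg)
    have c: "ffn_apply (feed_forward ?l) v \<in> carrier_vec d" for v
      by (rule carrier_vecI) (simp add: ffn_apply_def Avg)
    have z: "ffn_apply (feed_forward ?l) v $ k = 0" if "k < d" for v k
      using that by (simp add: ffn_apply_def Avg scalar_prod_def)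
    have "(?V *\<^sub>v col A p) $ k = (if k = i then lincomb u (x p) else 0)"
      if "k < d" "p < n" for k p
    proof (cases "k = i")
      case True
      then have "row ?V k = vec d (coeff_of u)" using that by (auto simp: row_def)
      moreover have "vec d (coeff_of u) \<bullet> col A p = lincomb u (x p)"
        using assms(3) A x that by (intro scalar_prod_coeff_of) (auto simp: Avg)
      ultimately show ?thesis using that True by simp
    next
      case False
      then show ?thesis using that A by (simp add: scalar_prod_def)
    qed
    then have A': "?A' $$ (k, q) =
        (if k = i then (\<Sum>p<n. lincomb u (x p)) / real n else 0) + x q k"
      if "k < d" "q < n" for k q
      using that A x by (simp add: self_attention_uniform)
    have "layer_apply ?l A $$ (k, q) = exec n ins x q k" if "k < d" "q < n" for k q
      using layer_apply_uniform(2)[OF A h c that]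
      unfolding z[OF that(1)] A'[OF that] by (simp add: Avg)
    then show ?thesis
      using layer_apply_uniform(1)[OF A h c] unfolding represents_def by blast
  qed
qed

lemma represents_stack:
  assumes "represents d n A x" "\<And>ins. ins \<in> set prog \<Longrightarrow> target ins < d \<and> operands ins \<subseteq> {..<d}"
  shows "represents d n (stack_apply (map (compile d) prog) A) (fold (exec n) prog x)"
  using assms
proof (induction prog arbitrary: A x)
  case (Cons ins prog)
  then show ?case
    using represents_compile[of d n A x ins] by (simp add: stack_apply_def)
qed (simp add: stack_apply_def)

lemma fold_exec_frame:
  assumes "\<And>ins. ins \<in> set prog \<Longrightarrow> target ins \<noteq> i"
  shows "fold (exec n) prog x q i = x q i"
  using assms
proof (induction prog arbitrary: x)
  case (Cons ins prog)
  have "exec n ins x q i = x q i" using Cons.prems[of ins] by (cases ins) auto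
  then show ?case using Cons by simp
qed simp

text \<open>Writing is confined to one block of registers while reading may also reach below it, so
  programs on consecutive blocks can be concatenated without overwriting results.\<close>

definition fits :: "nat \<Rightarrow> nat \<Rightarrow> instr list \<Rightarrow> bool" where
  "fits lo hi prog \<longleftrightarrow>
     (\<forall>ins\<in>set prog. lo \<le> target ins \<and> target ins < hi \<and> operands ins \<subseteq> {..<hi})"

lemma fits_append:
  assumes "fits a b prog" "fits b c prog'" "a \<le> b" "b \<le> c"
  shows "fits a c (prog @ prog')"
  using assms unfolding fits_def by fastforce


section \<open>Functions computed by transformers\<close>

text \<open>Registers 0 and 1 take the sine and cosine of the position, those from 2 to below
  \<open>K0\<close> the embedding of the symbol; all further registers start with 0 and serve as
  scratch space.\<close>

locale embedding =
  fixes \<Sigma> :: "'a set" and M :: nat and E :: "'a option \<Rightarrow> nat \<Rightarrow> real" and K0 :: nat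
  assumes K0: "2 \<le> K0" and E_beyond: "\<And>s i. K0 \<le> i \<Longrightarrow> E s i = 0"
begin

definition symbol :: "'a list \<Rightarrow> nat \<Rightarrow> 'a option" where
  "symbol w q = (None # map Some w) ! q"

definition init :: "'a list \<Rightarrow> nat \<Rightarrow> nat \<Rightarrow> real" where
  "init w q i =
     (if i = 0 then sin (2 * pi * real q / real M)
      else if i = 1 then cos (2 * pi * real q / real M)
      else E (symbol w q) i)"

definition run :: "instr list \<Rightarrow> 'a list \<Rightarrow> nat \<Rightarrow> nat \<Rightarrow> real" where
  "run prog w = fold (exec (length w + 1)) prog (init w)"

lemma run_append: "run (prog @ prog') w = fold (exec (length w + 1)) prog' (run prog w)"
  by (simp add: run_def)

text \<open>Instructions add to their target, so a result must go to a register that still holds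
  0.\<close>

lemma run_fresh:
  assumes "fits K0 K prog" "K0 \<le> K" "K \<le> i"
  shows "run prog w q i = 0"
proof -
  have "run prog w q i = init w q i"
    unfolding run_def using assms by (intro fold_exec_frame) (auto simp: fits_def)
  then show ?thesis using assms K0 by (simp add: init_def E_beyond)
qed

text \<open>The appended program writes only at \<open>K\<close> and above, so combinations of lower
  registers keep their values.\<close>

lemma lincomb_run_append:
  assumes "fits K K' prog'" "snd ` set u \<subseteq> {..<K}"
  shows "lincomb u (run (prog @ prog') w q) = lincomb u (run prog w q)"
  unfolding run_append using assms
  by (intro lincomb_cong fold_exec_frame) (fastforce simp: fits_def)

text \<open>
  Quantifying over an arbitrary program that is run before makes computations composable without
  renaming registers.
\<close>

definition computable :: "('a list \<Rightarrow> nat \<Rightarrow> real) \<Rightarrow> bool" where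
  "computable f \<longleftrightarrow> (\<forall>K prog. K0 \<le> K \<longrightarrow> fits K0 K prog \<longrightarrow>
     (\<exists>K' prog' u. K \<le> K' \<and> fits K K' prog' \<and> snd ` set u \<subseteq> {..<K'} \<and>
       (\<forall>w\<in>lists \<Sigma>. \<forall>q\<le>length w. lincomb u (run (prog @ prog') w q) = f w q)))"

lemma computableI:
  assumes "\<And>K prog. K0 \<le> K \<Longrightarrow> fits K0 K prog \<Longrightarrow>
     \<exists>K' prog' u. K \<le> K' \<and> fits K K' prog' \<and> snd ` set u \<subseteq> {..<K'} \<and>
       (\<forall>w\<in>lists \<Sigma>. \<forall>q\<le>length w. lincomb u (run (prog @ prog') w q) = f w q)"
  shows "computable f"
  unfolding computable_def using assms by simp

lemma computableD:
  assumes "computable f" "K0 \<le> K" "fits K0 K prog"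
  shows "\<exists>K' prog' u. K \<le> K' \<and> fits K K' prog' \<and> snd ` set u \<subseteq> {..<K'} \<and>
     (\<forall>w\<in>lists \<Sigma>. \<forall>q\<le>length w. lincomb u (run (prog @ prog') w q) = f w q)"
  using assms unfolding computable_def by simp

lemma computable_cong:
  assumes "computable f" "\<And>w q. w \<in> lists \<Sigma> \<Longrightarrow> q \<le> length w \<Longrightarrow> f w q = g w q"
  shows "computable g"
proof -
  have "(\<forall>w\<in>lists \<Sigma>. \<forall>q\<le>length w. h w q = f w q) =
      (\<forall>w\<in>lists \<Sigma>. \<forall>q\<le>length w. h w q = g w q)" for h
    using assms(2) by simp
  then show ?thesis using assms(1) unfolding computable_def by simp
qed

lemma computable_init:
  assumes "i < K0"
  shows "computable (\<lambda>w q. init w q i)"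
proof (rule computableI)
  fix K prog assume K: "K0 \<le> K" "fits K0 K prog"
  have "run prog w q i = init w q i" for w q
    unfolding run_def using K assms by (intro fold_exec_frame) (auto simp: fits_def)
  then show "\<exists>K' prog' u. K \<le> K' \<and> fits K K' prog' \<and> snd ` set u \<subseteq> {..<K'} \<and>
    (\<forall>w\<in>lists \<Sigma>. \<forall>q\<le>length w. lincomb u (run (prog @ prog') w q) = init w q i)"
    using K assms
    by (intro exI[of _ K] exI[of _ "[]"] exI[of _ "[(1, i)]"]) (simp add: fits_def)
qed

text \<open>Scaling changes only the combination that is read out; the program stays the
  same.\<close>

lemma computable_scale:
  assumes "computable f"
  shows "computable (\<lambda>w q. a * f w q)"
proof (rule computableI)
  fix K prog assume "K0 \<le> K" "fits K0 K prog"
  then obtain K' prog' u where "K \<le> K'" "fits K K' prog'" "snd ` set u \<subseteq> {..<K'}"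
    "\<forall>w\<in>lists \<Sigma>. \<forall>q\<le>length w. lincomb u (run (prog @ prog') w q) = f w q"
    using computableD[OF assms] by blast
  then show "\<exists>K' prog' u. K \<le> K' \<and> fits K K' prog' \<and> snd ` set u \<subseteq> {..<K'} \<and>
    (\<forall>w\<in>lists \<Sigma>. \<forall>q\<le>length w. lincomb u (run (prog @ prog') w q) = a * f w q)"
    by (intro exI[of _ K'] exI[of _ prog'] exI[of _ "map (\<lambda>(c, i). (a * c, i)) u"])
      (auto simp: lincomb_map_scale)
qed

lemma computable_add:
  assumes "computable f" "computable g"
  shows "computable (\<lambda>w q. f w q + g w q)"
proof (rule computableI)
  fix K prog assume K: "K0 \<le> K" "fits K0 K prog"
  obtain K1 prog1 u1 where 1: "K \<le> K1" "fits K K1 prog1" "snd ` set u1 \<subseteq> {..<K1}"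
    "\<forall>w\<in>lists \<Sigma>. \<forall>q\<le>length w. lincomb u1 (run (prog @ prog1) w q) = f w q"
    using computableD[OF assms(1) K] by blast
  \<comment> \<open>The program for \<open>f\<close> joins the prefix of the program for
    \<open>g\<close>, which therefore writes only from \<open>K1\<close> on.\<close>
  have "K0 \<le> K1" "fits K0 K1 (prog @ prog1)" using K 1 fits_append by auto
  then obtain K2 prog2 u2 where
    2: "K1 \<le> K2" "fits K1 K2 prog2" "snd ` set u2 \<subseteq> {..<K2}"
    "\<forall>w\<in>lists \<Sigma>. \<forall>q\<le>length w. lincomb u2 (run ((prog @ prog1) @ prog2) w q) = g w q"
    using computableD[OF assms(2)] by blast
  have "lincomb u1 (run ((prog @ prog1) @ prog2) w q) = f w q"
    if "w \<in> lists \<Sigma>" "q \<le> length w" for w q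
    using lincomb_run_append[OF 2(2) 1(3), of "prog @ prog1" w q] 1(4) that by simp
  moreover have "fits K K2 (prog1 @ prog2)" using fits_append 1 2 by blast
  ultimately show "\<exists>K' prog' u. K \<le> K' \<and> fits K K' prog' \<and> snd ` set u \<subseteq> {..<K'} \<and>
    (\<forall>w\<in>lists \<Sigma>. \<forall>q\<le>length w. lincomb u (run (prog @ prog') w q) = f w q + g w q)"
    using 1 2 by (intro exI[of _ K2] exI[of _ "prog1 @ prog2"] exI[of _ "u1 @ u2"]) auto
qed

lemma computable_diff:
  assumes "computable f" "computable g"
  shows "computable (\<lambda>w q. f w q - g w q)"
  using computable_add[OF assms(1) computable_scale[OF assms(2), of "-1"]] by simp

lemma computable_relu:
  assumes "computable f"
  shows "computable (\<lambda>w q. max 0 (f w q))"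
proof (rule computableI)
  fix K prog assume K: "K0 \<le> K" "fits K0 K prog"
  obtain K1 prog1 u where 1: "K \<le> K1" "fits K K1 prog1" "snd ` set u \<subseteq> {..<K1}"
    "\<forall>w\<in>lists \<Sigma>. \<forall>q\<le>length w. lincomb u (run (prog @ prog1) w q) = f w q"
    using computableD[OF assms(1) K] by blast
  \<comment> \<open>Register \<open>K1\<close> is the first one beyond the program so far; it still
    holds 0 and receives the result.\<close>
  have "K0 \<le> K1" "fits K0 K1 (prog @ prog1)" using K 1 fits_append by auto
  then have "run (prog @ prog1) w q K1 = 0" for w q by (simp add: run_fresh)
  then have "lincomb [(1, K1)] (run (prog @ prog1 @ [Relu K1 u]) w q) = max 0 (f w q)"
    if "w \<in> lists \<Sigma>" "q \<le> length w" for w q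
    using 1(4) that run_append[of "prog @ prog1" "[Relu K1 u]" w] by simp
  moreover have "fits K (Suc K1) (prog1 @ [Relu K1 u])"
    using 1 by (intro fits_append[of K K1]) (auto simp: fits_def)
  ultimately show "\<exists>K' prog' u. K \<le> K' \<and> fits K K' prog' \<and> snd ` set u \<subseteq> {..<K'} \<and>
    (\<forall>w\<in>lists \<Sigma>. \<forall>q\<le>length w. lincomb u (run (prog @ prog') w q) = max 0 (f w q))"
    using 1(1) by (intro exI[of _ "Suc K1"] exI[of _ "prog1 @ [Relu K1 u]"] exI[of _ "[(1, K1)]"]) auto
qed

text \<open>The average runs over all columns, including that of \<open>CLS\<close>; this is why
  \<open>computable\<close> prescribes values in every column and not only in column 0.\<close>

lemma computable_mean:
  assumes "computable f"
  shows "computable (\<lambda>w q. (\<Sum>p\<le>length w. f w p) / real (length w + 1))"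
proof (rule computableI)
  fix K prog assume K: "K0 \<le> K" "fits K0 K prog"
  obtain K1 prog1 u where 1: "K \<le> K1" "fits K K1 prog1" "snd ` set u \<subseteq> {..<K1}"
    "\<forall>w\<in>lists \<Sigma>. \<forall>q\<le>length w. lincomb u (run (prog @ prog1) w q) = f w q"
    using computableD[OF assms(1) K] by blast
  have "K0 \<le> K1" "fits K0 K1 (prog @ prog1)" using K 1 fits_append by auto
  then have fresh: "run (prog @ prog1) w q K1 = 0" for w q by (simp add: run_fresh)
  have "lincomb [(1, K1)] (run (prog @ prog1 @ [Avg K1 u]) w q) =
      (\<Sum>p\<le>length w. f w p) / real (length w + 1)" if "w \<in> lists \<Sigma>" for w q
  proof -
    have "(\<Sum>p<length w + 1. lincomb u (run (prog @ prog1) w p)) = (\<Sum>p\<le>length w. f w p)"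
      using 1(4) that by (intro sum.cong) auto
    then show ?thesis using fresh run_append[of "prog @ prog1" "[Avg K1 u]" w] by simp
  qed
  moreover have "fits K (Suc K1) (prog1 @ [Avg K1 u])"
    using 1 by (intro fits_append[of K K1]) (auto simp: fits_def)
  ultimately show "\<exists>K' prog' u. K \<le> K' \<and> fits K K' prog' \<and> snd ` set u \<subseteq> {..<K'} \<and>
    (\<forall>w\<in>lists \<Sigma>. \<forall>q\<le>length w. lincomb u (run (prog @ prog') w q) =
      (\<Sum>p\<le>length w. f w p) / real (length w + 1))"
    using 1(1) by (intro exI[of _ "Suc K1"] exI[of _ "prog1 @ [Avg K1 u]"] exI[of _ "[(1, K1)]"]) auto
qed

text \<open>
  Only the first frequency is nonzero; the other sines and cosines are the constants 0 and 1, and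
  the latter are cancelled by the word embedding.
\<close>

definition classifier_of :: "nat \<Rightarrow> instr list \<Rightarrow> lincomb \<Rightarrow> 'a classifier" where
  "classifier_of k prog u =
     \<lparr>word_emb = (\<lambda>s. vec (2 * k) (\<lambda>i. if i < 2 then 0 else E s i - (if odd i then 1 else 0))),
      freqs = (1 / of_nat M) # replicate (k - 1) 0,
      layers = map (compile (2 * k)) prog,
      W_out = mat 1 (2 * k) (\<lambda>(_, j). coeff_of u j),
      b_out = 0\<rparr>"

lemma wf_classifier_of: "0 < k \<Longrightarrow> wf_classifier \<Sigma> (2 * k) (classifier_of k prog u)"
  by (auto simp: wf_classifier_def classifier_of_def wf_layer_compile)

lemma represents_input:
  assumes "0 < k"
  shows "represents (2 * k) (length w + 1)
    (input_matrix (2 * k) (classifier_of k prog u) w) (init w)"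
proof -
  let ?T = "classifier_of k prog u"
  have pe: "pos_enc (freqs ?T) p $ i = (if i = 0 then sin (2 * pi * real p / real M)
      else if i = 1 then cos (2 * pi * real p / real M) else if odd i then 1 else 0)"
    if "i < 2 * k" for p i
  proof (cases "i < 2")
    case True
    then have "i = 0 \<or> i = 1" by auto
    then show ?thesis
      using that by (auto simp: pos_enc_def classifier_of_def of_rat_divide)
  next
    case False
    \<comment> \<open>Past the first two entries, the index \<open>i div 2\<close> hits one of the
      zero frequencies.\<close>
    then have "0 < i div 2" "i div 2 < k" using that by auto
    then obtain j where "i div 2 = Suc j" "j < k - 1" by (cases "i div 2") auto
    then show ?thesis using that False by (auto simp: pos_enc_def classifier_of_def)
  qed
  have len: "dim_vec (pos_enc (freqs ?T) p) = 2 * k" for p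
    using assms by (simp add: pos_enc_def classifier_of_def)
  have "input_matrix (2 * k) ?T w $$ (i, q) = init w q i" if "q < length w + 1" "i < 2 * k" for q i
  proof -
    have "input_matrix (2 * k) ?T w $$ (i, q) =
        (word_emb ?T (symbol w q) + pos_enc (freqs ?T) q) $ i"
      using that by (simp add: input_matrix_def mat_of_cols_index symbol_def del: upt_Suc)
    also have "\<dots> = word_emb ?T (symbol w q) $ i + pos_enc (freqs ?T) q $ i"
      using that len by simp
    also have "\<dots> = init w q i"
      unfolding pe[OF that(2)] using that(2) by (auto simp: init_def classifier_of_def)
    finally show ?thesis .
  qed
  moreover have "input_matrix (2 * k) ?T w \<in> carrier_mat (2 * k) (length w + 1)"
    by (rule carrier_matI) (simp_all add: input_matrix_def del: upt_Suc)
  ultimately show ?thesis unfolding represents_def by blast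
qed

lemma recognizable_if_computable:
  assumes "computable f"
  shows "transformer_recognizable \<Sigma> {w \<in> lists \<Sigma>. 0 \<le> f w 0}"
proof -
  have "fits K0 K0 []" by (simp add: fits_def)
  then obtain k prog u where k: "K0 \<le> k" "fits K0 k prog" "snd ` set u \<subseteq> {..<k}"
    and f: "\<forall>w\<in>lists \<Sigma>. \<forall>q\<le>length w. lincomb u (run ([] @ prog) w q) = f w q"
    using computableD[OF assms order_refl] by blast
  \<comment> \<open>Doubling \<open>k\<close> makes the width even; the program touches only
    registers below \<open>k\<close>.\<close>
  let ?T = "classifier_of k prog u" and ?d = "2 * k"
  have "0 < k" using k(1) K0 by simp
  have "accepts ?d ?T w \<longleftrightarrow> 0 \<le> f w 0" if "w \<in> lists \<Sigma>" for w
  proof -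
    have "represents ?d (length w + 1) (encode ?d ?T w) (run prog w)"
    proof -
      have "target ins < ?d \<and> operands ins \<subseteq> {..<?d}" if "ins \<in> set prog" for ins
        using that k(2) by (fastforce simp: fits_def)
      from represents_stack[OF represents_input[OF \<open>0 < k\<close>] this]
      show ?thesis by (simp add: encode_def run_def classifier_of_def)
    qed
    then have "vec ?d (coeff_of u) \<bullet> col (encode ?d ?T w) 0 = lincomb u (run prog w 0)"
      using k(3) by (intro scalar_prod_coeff_of) (auto simp: represents_def)
    moreover have "row (W_out ?T) 0 = vec ?d (coeff_of u)"
      by (auto simp: classifier_of_def row_def)
    ultimately have "classify ?d ?T w = sigmoid (f w 0)"
      using f that by (simp add: classify_def) (simp add: classifier_of_def)
    moreover have "1 / 2 \<le> sigmoid r \<longleftrightarrow> 0 \<le> r" for r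
      by (simp add: sigmoid_def field_simps add_pos_pos)
    ultimately show ?thesis by (simp add: accepts_def)
  qed
  then show ?thesis
    unfolding transformer_recognizable_def using wf_classifier_of[OF \<open>0 < k\<close>] by blast
qed

end


section \<open>Counting types and deciding semilinear conditions\<close>

lemma cos_shift_period: "cos (x + 2 * pi * real n) = cos x"
proof -
  have "2 * pi * real n = 2 * real n * pi" by simp
  then show ?thesis by (simp only: cos_add cos_2npi sin_2npi mult_1_right mult_zero_right diff_zero)
qed

lemma cos_residue:
  assumes "0 < M"
  shows "cos (2 * pi * (real q - real r) / real M) = cos (2 * pi * (real (q mod M) - real r) / real M)"
proof -
  have "real q = real M * real (q div M) + real (q mod M)"
    by (metis mult_div_mod_eq of_nat_add of_nat_mult)
  then have "2 * pi * (real q - real r) / real M =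
      2 * pi * (real (q mod M) - real r) / real M + 2 * pi * real (q div M)"
    using assms by (simp add: field_simps)
  then show ?thesis by (simp only: cos_shift_period)
qed

text \<open>For distinct residues the angle is no multiple of a full turn, so the cosine is below 1.
  By periodicity only finitely many residues matter, and their gaps have a positive minimum.\<close>

lemma cos_residue_gap:
  assumes "r < M"
  obtains \<delta> where "0 < \<delta>" "\<And>q. q mod M \<noteq> r \<Longrightarrow> cos (2 * pi * (real q - real r) / real M) \<le> 1 - \<delta>"
proof -
  define f where "f j = 1 - cos (2 * pi * (real j - real r) / real M)" for j :: nat
  \<comment> \<open>The extra element 1 keeps the set nonempty for \<open>M = 1\<close>, where no
    other residue exists.\<close>
  define S where "S = insert 1 (f ` {j. j < M \<and> j \<noteq> r})"
  have S: "finite S" "S \<noteq> {}" by (auto simp: S_def)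
  have "0 < f j" if "j < M" "j \<noteq> r" for j
  proof -
    have "cos (2 * pi * (real j - real r) / real M) \<noteq> 1"
    proof
      assume "cos (2 * pi * (real j - real r) / real M) = 1"
      then obtain n :: int where "2 * pi * (real j - real r) / real M = of_int n * 2 * pi"
        unfolding cos_one_2pi_int by blast
      then have "(2 * pi) * ((real j - real r) / real M) = (2 * pi) * of_int n"
        by (simp add: mult_ac)
      then have "(real j - real r) / real M = of_int n" by (simp only: mult_cancel_left) simp
      then have "real j - real r = of_int n * real M" using assms by (simp add: field_simps)
      then have "of_int (int j - int r) = (of_int (n * int M) :: real)" by simp
      then have *: "int j - int r = n * int M" by (simp only: of_int_eq_iff)
      \<comment> \<open>A multiple of \<open>M\<close> of absolute value below \<open>M\<close> is
        0.\<close>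
      have "\<bar>int j - int r\<bar> < int M" using that(1) assms by linarith
      then have "n = 0" using * by (auto simp: abs_mult) (smt (verit) mult_less_cancel_right2 of_nat_0_le_iff)
      then show False using * that(2) by simp
    qed
    then show ?thesis by (simp add: f_def less_le)
  qed
  then have pos: "0 < Min S" using S by (auto simp: S_def)
  have "cos (2 * pi * (real q - real r) / real M) \<le> 1 - Min S" if "q mod M \<noteq> r" for q
  proof -
    have "f (q mod M) \<in> S" using that assms by (auto simp: S_def)
    then have "Min S \<le> f (q mod M)" using S by simp
    then show ?thesis using assms cos_residue[of M q r] by (simp add: f_def)
  qed
  then show thesis using that pos by blast
qed

section \<open>Indicators and counts of position types\<close>

text \<open>Register 2 marks the \<open>CLS\<close> column, so its mean is the inverse of the number
  of columns; register 3 supplies constants; one-hot letters follow. Registers 0 and 1 are left to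
  the positional encoding.\<close>

definition letter_embedding :: "'a set \<Rightarrow> ('a \<Rightarrow> nat) \<Rightarrow> 'a option \<Rightarrow> nat \<Rightarrow> real" where
  "letter_embedding \<Sigma> idx s i =
     (if i = 2 then if s = None then 1 else 0
      else if i = 3 then 1
      else case s of None \<Rightarrow> 0 | Some a \<Rightarrow> if a \<in> \<Sigma> \<and> i = 4 + idx a then 1 else 0)"

locale letter_counting =
  fixes \<Sigma> :: "'a set" and M :: nat and idx :: "'a \<Rightarrow> nat" and N :: nat
  assumes M: "0 < M" and idx: "inj_on idx \<Sigma>" "idx ` \<Sigma> \<subseteq> {..<N}"
begin

sublocale embedding \<Sigma> M "letter_embedding \<Sigma> idx" "4 + N"
  using idx(2) by unfold_locales (auto simp: letter_embedding_def split: option.split)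

lemma symbol_0 [simp]: "symbol w 0 = None"
  by (simp add: symbol_def)

lemma symbol_pos [simp]: "0 < q \<Longrightarrow> q \<le> length w \<Longrightarrow> symbol w q = Some (w ! (q - 1))"
  by (auto simp: symbol_def nth_Cons split: nat.split)

lemma computable_const: "computable (\<lambda>w q. c)"
proof -
  have "init w q 3 = 1" for w q by (simp add: init_def letter_embedding_def)
  then show ?thesis using computable_scale[OF computable_init[of 3], of c] by simp
qed

lemma computable_inverse_length: "computable (\<lambda>w q. 1 / real (length w + 1))"
proof (rule computable_cong[OF computable_mean[OF computable_init[of 2]]])
  fix w :: "'a list" and q
  have "(\<Sum>p\<le>length w. init w p 2) = (\<Sum>p\<le>length w. if p = 0 then 1 else 0)"
    by (intro sum.cong) (auto simp: init_def letter_embedding_def)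
  then show "(\<Sum>p\<le>length w. init w p 2) / real (length w + 1) = 1 / real (length w + 1)"
    by simp
qed simp

text \<open>The guard \<open>0 < q\<close> matters in column 0: truncated subtraction would inspect
  \<open>w ! 0\<close> there, whereas \<open>CLS\<close> carries no letter.\<close>

lemma computable_letter:
  assumes "a \<in> \<Sigma>"
  shows "computable (\<lambda>w q. if 0 < q \<and> w ! (q - 1) = a then 1 else 0)"
proof (rule computable_cong[OF computable_init[of "4 + idx a"]])
  show "4 + idx a < 4 + N" using assms idx(2) by auto
next
  fix w :: "'a list" and q assume w: "w \<in> lists \<Sigma>" "q \<le> length w"
  show "init w q (4 + idx a) = (if 0 < q \<and> w ! (q - 1) = a then 1 else 0)"
  proof (cases "q = 0")
    case True
    then show ?thesis by (simp add: init_def letter_embedding_def)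
  next
    case False
    then have "w ! (q - 1) \<in> set w" using w(2) by (intro nth_mem) simp
    then have "w ! (q - 1) \<in> \<Sigma>" using w(1) by (auto simp: in_lists_conv_set)
    then show ?thesis
      using False w(2) assms inj_onD[OF idx(1)] by (auto simp: init_def letter_embedding_def)
  qed
qed

text \<open>
  \<open>cos (2 \<pi> (q - r) / M)\<close> is a linear combination of the positional encoding; it is 1 if \<open>q\<close> has
  residue \<open>r\<close> and otherwise bounded away from 1, so that a single ReLU can test residue and letter.
\<close>

lemma computable_type:
  assumes "a \<in> \<Sigma>" "r < M"
  shows "computable (\<lambda>w q. if 0 < q \<and> pos_type M w q = (a, r) then 1 else 0)"
proof -
  obtain \<delta> where \<delta>: "0 < \<delta>"
    "\<And>q. q mod M \<noteq> r \<Longrightarrow> cos (2 * pi * (real q - real r) / real M) \<le> 1 - \<delta>"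
    using cos_residue_gap[OF assms(2)] by blast
  let ?x = "2 * pi * real r / real M"
  let ?L = "\<lambda>w q. if 0 < q \<and> w ! (q - 1) = a then 1 else 0"
  let ?C = "\<lambda>w q. cos ?x * init w q 1 + sin ?x * init w q 0"
  \<comment> \<open>The factor \<open>1 / \<delta>\<close> enlarges the gap to at least 1, so a
    wrong residue outweighs the letter indicator and the ReLU returns 0.\<close>
  let ?F = "\<lambda>w q. max 0 (1 / \<delta> * (?C w q - 1) + ?L w q)"
  have "computable ?F"
    by (intro computable_relu computable_add computable_scale computable_diff computable_const
        computable_init computable_letter assms) simp_all
  moreover have "?F w q = (if 0 < q \<and> pos_type M w q = (a, r) then 1 else 0)" for w q
  proof -
    have "?C w q = cos (2 * pi * real q / real M) * cos ?x + sin (2 * pi * real q / real M) * sin ?x"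
      by (simp add: init_def)
    also have "\<dots> = cos (2 * pi * real q / real M - ?x)" by (rule cos_diff[symmetric])
    also have "2 * pi * real q / real M - ?x = 2 * pi * (real q - real r) / real M"
      by (simp add: diff_divide_distrib right_diff_distrib)
    finally have C: "?C w q = cos (2 * pi * (real q - real r) / real M)" .
    show ?thesis
    proof (cases "q mod M = r")
      case True
      have "?C w q = 1" unfolding C by (subst cos_residue[OF M]) (simp add: True)
      then show ?thesis unfolding \<open>?C w q = 1\<close> using True by (simp add: pos_type_def)
    next
      case False
      then have "?C w q - 1 \<le> - \<delta>" unfolding C using \<delta>(2) by fastforce
      then have "1 / \<delta> * (?C w q - 1) \<le> 1 / \<delta> * - \<delta>" using \<delta>(1) by (intro mult_left_mono) auto
      then have "1 / \<delta> * (?C w q - 1) \<le> - 1" using \<delta>(1) by simp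
      then have "?F w q = 0" by (auto simp: max_def)
      then show ?thesis using False by (simp add: pos_type_def)
    qed
  qed
  ultimately show ?thesis by simp
qed

text \<open>The count is the sum of the type indicators, to which column 0 contributes 0. Affine
  functions may mention any \<open>Inr k\<close>, so types outside
  \<open>\<Sigma> \<times> {..<M}\<close> are covered too; their count is 0.\<close>

lemma computable_type_count: "computable (\<lambda>w q. real (type_count M w k) / real (length w + 1))"
proof (cases "k \<in> \<Sigma> \<times> {..<M}")
  case True
  then obtain a r where k: "k = (a, r)" "a \<in> \<Sigma>" "r < M" by auto
  show ?thesis
  proof (rule computable_cong[OF computable_mean[OF computable_type[OF k(2,3)]]])
    fix w :: "'a list" and q :: nat
    have "(\<Sum>p\<le>length w. if 0 < p \<and> pos_type M w p = (a, r) then 1 else 0 :: real) =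
        real (card {p \<in> {..length w}. 0 < p \<and> pos_type M w p = (a, r)})"
      by (simp add: sum.If_cases Int_def)
    also have "{p \<in> {..length w}. 0 < p \<and> pos_type M w p = (a, r)} =
        {p \<in> {1..length w}. pos_type M w p = k}"
      using k(1) by auto
    finally show "(\<Sum>p\<le>length w. if 0 < p \<and> pos_type M w p = (a, r) then 1 else 0) /
        real (length w + 1) = real (type_count M w k) / real (length w + 1)"
      by (simp add: type_count_def)
  qed
next
  case False
  show ?thesis
  proof (rule computable_cong[OF computable_const[of 0]])
    fix w :: "'a list" and q :: nat assume w: "w \<in> lists \<Sigma>"
    have "pos_type M w i \<noteq> k" if "i \<in> {1..length w}" for i
      using pos_type_in[OF w M that] False by auto
    then have "{i \<in> {1..length w}. pos_type M w i = k} = {}" by blast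
    then show "0 = real (type_count M w k) / real (length w + 1)" by (simp add: type_count_def)
  qed
qed

text \<open>The positive denominator is inherited from averaging and preserves signs. Count
  variables are fixed to 0, which is enough for sentences.\<close>

lemma computable_affine:
  assumes "affine t"
  shows "computable (\<lambda>w q. of_rat (t (env M w (\<lambda>_. 0))) / real (length w + 1))"
  using assms
proof (induction rule: affine.induct)
  case (affine_const c)
  show ?case using computable_scale[OF computable_inverse_length, of "of_rat c"] by simp
next
  case (affine_var v)
  then show ?case
    using computable_const[of 0] computable_type_count by (cases v) simp_all
next
  case (affine_add s t)
  then show ?case
    using computable_add[OF affine_add.IH] by (simp add: of_rat_add add_divide_distrib)
next
  case (affine_scale t c)
  then show ?case
    using computable_scale[OF affine_scale.IH, of "of_rat c"] by (simp add: of_rat_mult)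
qed

text \<open>Only column 0 matters, as the classifier reads no other. The invariant
  \<open>f w 0 \<noteq> 0\<close> makes negation a change of sign and passes through negation and
  minimum.\<close>

lemma computable_semilinear:
  assumes "semilinear P"
  shows "\<exists>f. computable f \<and> (\<forall>w. f w 0 \<noteq> 0 \<and> (P (env M w (\<lambda>_. 0)) \<longleftrightarrow> 0 < f w 0))"
  using assms
proof (induction rule: semilinear.induct)
  case (semilinear_pos t)
  obtain D :: int where D: "0 < D" "\<And>e. (\<forall>v. e v \<in> \<int>) \<Longrightarrow> of_int D * t e \<in> \<int>"
    using affine_denominator[OF semilinear_pos] by blast
  \<comment> \<open>Half of the spacing \<open>1 / D\<close> between the possible values of
    \<open>t\<close>.\<close>
  define d where "d = 1 / (2 * real_of_int D)"
  define f where "f w q = of_rat (t (env M w (\<lambda>_. 0))) / real (length w + 1) -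
      d * (1 / real (length w + 1))" for w :: "'a list" and q :: nat
  have "computable f"
    unfolding f_def[abs_def]
    by (intro computable_diff computable_scale computable_affine computable_inverse_length semilinear_pos)
  moreover have "f w 0 \<noteq> 0 \<and> (0 < t (env M w (\<lambda>_. 0)) \<longleftrightarrow> 0 < f w 0)" for w
  proof -
    let ?t = "t (env M w (\<lambda>_. 0))"
    have "\<forall>v. env M w (\<lambda>_. 0) v \<in> \<int>" by (auto simp: env_def split: sum.split)
    then obtain m where m: "of_int D * ?t = of_int m" using D(2) Ints_cases by blast
    then have "?t = of_int m / of_int D" using D(1) by (simp add: field_simps)
    then have "f w 0 = (real_of_int m / real_of_int D - d) / real (length w + 1)"
      by (simp add: f_def of_rat_divide diff_divide_distrib)
    also have "real_of_int m / real_of_int D - d = d * (2 * real_of_int m - 1)"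
      using D(1) by (simp add: d_def field_simps)
    finally have f: "f w 0 = d * (2 * real_of_int m - 1) / real (length w + 1)" .
    have "0 < d" using D(1) by (simp add: d_def)
    \<comment> \<open>The half-unit shift leaves an odd numerator, which cannot vanish.\<close>
    have "2 * real_of_int m \<noteq> 1"
    proof
      assume "2 * real_of_int m = 1"
      then have "real_of_int (2 * m) = real_of_int 1" by simp
      then have "2 * m = 1" by (simp only: of_int_eq_iff)
      then show False by presburger
    qed
    moreover have "0 < ?t \<longleftrightarrow> 0 < m"
      using \<open>?t = of_int m / of_int D\<close> D(1) by (simp add: zero_less_divide_iff)
    moreover have "0 < m \<longleftrightarrow> 0 < 2 * real_of_int m - 1" by linarith
    ultimately show ?thesis
      using \<open>0 < d\<close> by (simp add: f zero_less_divide_iff zero_less_mult_iff)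
  qed
  ultimately show ?case by blast
next
  case (semilinear_not P)
  then obtain f where f: "computable f"
    "\<forall>w. f w 0 \<noteq> 0 \<and> (P (env M w (\<lambda>_. 0)) \<longleftrightarrow> 0 < f w 0)" by blast
  have "computable (\<lambda>w q. -1 * f w q)" by (intro computable_scale f)
  moreover have "-1 * f w 0 \<noteq> 0 \<and> (\<not> P (env M w (\<lambda>_. 0)) \<longleftrightarrow> 0 < -1 * f w 0)" for w
    using f(2)[rule_format, of w] by auto
  ultimately show ?case by (intro exI[of _ "\<lambda>w q. -1 * f w q"]) simp
next
  case (semilinear_conj P Q)
  then obtain f g where
    f: "computable f" "\<forall>w. f w 0 \<noteq> 0 \<and> (P (env M w (\<lambda>_. 0)) \<longleftrightarrow> 0 < f w 0)" and
    g: "computable g" "\<forall>w. g w 0 \<noteq> 0 \<and> (Q (env M w (\<lambda>_. 0)) \<longleftrightarrow> 0 < g w 0)" by blast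
  \<comment> \<open>A minimum computed with one ReLU.\<close>
  let ?h = "\<lambda>w q. f w q - max 0 (f w q - g w q)"
  have "computable ?h" by (intro computable_diff computable_relu f g)
  moreover have "?h w q = min (f w q) (g w q)" for w q by (simp add: max_def min_def)
  then have "?h w 0 \<noteq> 0 \<and> (P (env M w (\<lambda>_. 0)) \<and> Q (env M w (\<lambda>_. 0)) \<longleftrightarrow> 0 < ?h w 0)" for w
    using f(2)[rule_format, of w] g(2)[rule_format, of w] by (auto simp: min_def)
  ultimately show ?case by (intro exI[of _ ?h]) blast
qed

end

section \<open>From sentences to classifiers\<close>

theorem theorem5:
  fixes \<Sigma> :: "'a set" and L :: "'a list set"
  assumes "finite \<Sigma>"
    and "L \<subseteq> lists \<Sigma>"
    and "foc_definable \<Sigma> L"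
  shows "transformer_recognizable \<Sigma> L"
proof -
  obtain \<sigma> where \<sigma>: "sentence \<Sigma> \<sigma>" "L = foc_language \<Sigma> \<sigma>"
    using assms(3) by (auto simp: foc_definable_def)
  define M where "M = modulus \<sigma>"
  have M: "0 < M" using \<sigma>(1) modulus_pos by (auto simp: M_def sentence_def)
  \<comment> \<open>Numbering the letters of the finite alphabet gives each its own
    register.\<close>
  obtain idx :: "'a \<Rightarrow> nat" and N where idx: "idx ` \<Sigma> = {i. i < N}" "inj_on idx \<Sigma>"
    using finite_imp_inj_to_nat_seg[OF assms(1)] by blast
  interpret letter_counting \<Sigma> M idx N
    using M idx by unfold_locales auto
  have "modulus \<sigma> dvd M" by (simp add: M_def)
  \<comment> \<open>A sentence has no free positions, so the condition on their types is
    vacuous.\<close>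
  from formula_semilinear[OF assms(1) M this] \<sigma>(1) obtain P where P: "semilinear P"
    "\<forall>w\<in>lists \<Sigma>. \<forall>\<alpha> \<beta>. sat w \<alpha> \<beta> \<sigma> \<longleftrightarrow> P (env M w \<beta>)"
    by (auto simp: sentence_def)
  obtain f where f: "computable f"
    "\<forall>w. f w 0 \<noteq> 0 \<and> (P (env M w (\<lambda>_. 0)) \<longleftrightarrow> 0 < f w 0)"
    using computable_semilinear[OF P(1)] by blast
  have "w \<Turnstile> \<sigma> \<longleftrightarrow> 0 \<le> f w 0" if w: "w \<in> lists \<Sigma>" for w
  proof -
    \<comment> \<open>The truth of a sentence is independent of the assignments, so the zero
      assignment of the computation may be chosen.\<close>
    have "sat w \<alpha> \<beta> \<sigma> \<longleftrightarrow> sat w (\<lambda>_. 0) (\<lambda>_. 0) \<sigma>" for \<alpha> \<beta>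
      using \<sigma>(1) by (intro sat_cong) (auto simp: sentence_def)
    then have "w \<Turnstile> \<sigma> \<longleftrightarrow> sat w (\<lambda>_. 0) (\<lambda>_. 0) \<sigma>" unfolding models_def by blast
    also have "\<dots> \<longleftrightarrow> P (env M w (\<lambda>_. 0))" using P(2) w by simp
    \<comment> \<open>As \<open>f w 0\<close> is never 0, the strict test agrees with the weak test
      of the classifier.\<close>
    also have "\<dots> \<longleftrightarrow> 0 \<le> f w 0" using f(2)[rule_format, of w] by auto
    finally show ?thesis .
  qed
  then have "L = {w \<in> lists \<Sigma>. 0 \<le> f w 0}" using \<sigma>(2) by (auto simp: foc_language_def)
  then show ?thesis using recognizable_if_computable[OF f(1)] by simp
qed

end
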